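(* Let $n>5$ be an integer and let $N$ be the homogeneous norm on the anisotropic Heisenberg group $\mathbb{R}^{2n+1}$ such that $N^{-2n}$ is (up to a constant multiple) the fundamental solution of the sub-Laplacian. Let $g:[0,\infty)\to[0,\infty)$ be a differentiable increasing function, twice differentiable on $[1,\infty)$, such that $g''(N)\le g'(N)^2$ on $\{N\ge1\}$. Let $d\mu=\frac{e^{-g(N)}}{Z}\,d\lambda$ be a probability measure, where $\lambda$ is Lebesgue measure on $\mathbb{R}^{2n+1}$ and $Z$ is the normalization constant. Then for every $q\ge2$ there are constants $C,D\in(0,\infty)$, independent of $f$, such that $$\int_{\{N\ge1\}}\frac{g'(N)}{N^{2}}|f|^{q}\,d\mu\ \le\ C\int_{\{N\ge1\}}|\nabla f|^{q}\,d\mu+D\int_{\{N\ge1\}}|f|^{q}\,d\mu$$ for every function $f$ for which the right-hand side is well defined.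
   Context: The anisotropic Heisenberg group is $\mathbb{R}^{2n+1}$, with points $(x,t)=(x_1,\dots,x_{2n},t)$ and group law $$(x,t)\circ(\eta,\tau)=\Big(x+\eta,\ t+\tau+\tfrac{x_1\eta_{n+1}}{2}-\tfrac{x_{n+1}\eta_1}{2}+\sum_{j=2}^n (x_j\eta_{j+n}-\eta_j x_{j+n})\Big).$$ The sub-gradient is $\nabla=(X_1,\dots,X_{2n})$, where $X_1=\partial_{x_1}-\frac{x_{n+1}}{2}\partial_t$, $X_{n+1}=\partial_{x_{n+1}}+\frac{x_1}{2}\partial_t$, $X_j=\partial_{x_j}-x_{j+n}\partial_t$ for $j=2,\dots,n$, and $X_j=\partial_{x_j}+x_{j-n}\partial_t$ for $j=n+2,\dots,2n$; $|\nabla f|^2=\sum_j (X_jf)^2$; the sub-Laplacian is $\sum_{j=1}^{2n}X_j^2$. The norm $N$ is given explicitly by $$N(x,t)=\frac{\left(B^{2}+t^{2}\right)^{\frac{1}{4n}}\left(AB+t^{2}+A\sqrt{B^{2}+t^{2}}\right)^{\frac{1}{2}-\frac{1}{4n}}}{\left(B+\sqrt{B^{2}+t^{2}}\right)^{\frac{1}{2}}}\quad((x,t)\ne0),\qquad N(0,0)=0,$$ with $A=\frac{x_1^2+x_{n+1}^2}{2}+\frac12\sum_{2\le j\le 2n,\,j\ne n+1}x_j^2$ and $B=\frac{x_1^2+x_{n+1}^2}{4}+\frac12\sum_{2\le j\le 2n,\,j\ne n+1}x_j^2$. *)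

theory Defs
  imports "HOL-Probability.Probability"
begin

text \<open>
  The space of dimension 2n + 1, where n is the cardinality of the index type. A point
  \<open>(x, y, t)\<close> has horizontal coordinates \<open>(x\<^sub>1, \<dots>, x\<^sub>n, x\<^sub>n\<^sub>+\<^sub>1, \<dots>, x\<^sub>2\<^sub>n)\<close> with \<open>y $ j\<close>
  in the role of the coordinate number n + j. The index type carries no enumeration; the parameter
  \<open>\<iota>\<close> below is the index of the distinguished, anisotropic pair, conventionally numbered 1.
\<close>

type_synonym 'n heis = "(real ^ 'n) \<times> (real ^ 'n) \<times> real"

definition aniso :: "'n \<Rightarrow> 'n \<Rightarrow> real" where
  "aniso \<iota> j = (if j = \<iota> then 1 / 2 else 1)"

text \<open>
  The coefficient vectors of the fields \<open>X\<^sub>j\<close> and \<open>X\<^sub>n\<^sub>+\<^sub>j\<close> at a point.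
\<close>

definition X_vec :: "'n::finite \<Rightarrow> 'n \<Rightarrow> 'n heis \<Rightarrow> 'n heis" where
  "X_vec \<iota> j = (\<lambda>(x, y, t). (axis j 1, 0, - aniso \<iota> j * y $ j))"

definition Y_vec :: "'n::finite \<Rightarrow> 'n \<Rightarrow> 'n heis \<Rightarrow> 'n heis" where
  "Y_vec \<iota> j = (\<lambda>(x, y, t). (0, axis j 1, aniso \<iota> j * x $ j))"

definition horizontally_differentiable_at :: "'n::finite \<Rightarrow> ('n heis \<Rightarrow> real) \<Rightarrow> 'n heis \<Rightarrow> bool" where
  "horizontally_differentiable_at \<iota> f p \<longleftrightarrow>
     (\<forall>j. (\<lambda>s::real. f (p + s *\<^sub>R X_vec \<iota> j p)) differentiable (at 0) \<and>
          (\<lambda>s::real. f (p + s *\<^sub>R Y_vec \<iota> j p)) differentiable (at 0))"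

definition X_deriv :: "'n::finite \<Rightarrow> 'n \<Rightarrow> ('n heis \<Rightarrow> real) \<Rightarrow> 'n heis \<Rightarrow> real" where
  "X_deriv \<iota> j f p = deriv (\<lambda>s::real. f (p + s *\<^sub>R X_vec \<iota> j p)) 0"

definition Y_deriv :: "'n::finite \<Rightarrow> 'n \<Rightarrow> ('n heis \<Rightarrow> real) \<Rightarrow> 'n heis \<Rightarrow> real" where
  "Y_deriv \<iota> j f p = deriv (\<lambda>s::real. f (p + s *\<^sub>R Y_vec \<iota> j p)) 0"

definition subgrad_norm :: "'n::finite \<Rightarrow> ('n heis \<Rightarrow> real) \<Rightarrow> 'n heis \<Rightarrow> real" where
  "subgrad_norm \<iota> f p = sqrt (\<Sum>j\<in>UNIV. (X_deriv \<iota> j f p)\<^sup>2 + (Y_deriv \<iota> j f p)\<^sup>2)"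

definition heis_A :: "'n::finite \<Rightarrow> 'n heis \<Rightarrow> real" where
  "heis_A \<iota> = (\<lambda>(x, y, t). ((x $ \<iota>)\<^sup>2 + (y $ \<iota>)\<^sup>2) / 2
     + 1 / 2 * (\<Sum>j\<in>UNIV - {\<iota>}. (x $ j)\<^sup>2 + (y $ j)\<^sup>2))"

definition heis_B :: "'n::finite \<Rightarrow> 'n heis \<Rightarrow> real" where
  "heis_B \<iota> = (\<lambda>(x, y, t). ((x $ \<iota>)\<^sup>2 + (y $ \<iota>)\<^sup>2) / 4
     + 1 / 2 * (\<Sum>j\<in>UNIV - {\<iota>}. (x $ j)\<^sup>2 + (y $ j)\<^sup>2))"

definition heis_norm :: "'n::finite \<Rightarrow> 'n heis \<Rightarrow> real" where
  "heis_norm \<iota> p =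
     (if p = 0 then 0 else
       let A = heis_A \<iota> p; B = heis_B \<iota> p; t = snd (snd p); n = real CARD('n) in
       (B\<^sup>2 + t\<^sup>2) powr (1 / (4 * n))
         * (A * B + t\<^sup>2 + A * sqrt (B\<^sup>2 + t\<^sup>2)) powr (1 / 2 - 1 / (4 * n))
         / (B + sqrt (B\<^sup>2 + t\<^sup>2)) powr (1 / 2))"

text \<open>
  The real functions for which the horizontal derivatives and the integrals over the complement of
  the unit ball make sense. No derivative is required on the level set where the norm is 1, which
  has measure zero.
\<close>

definition admissible :: "'n::finite \<Rightarrow> ('n heis \<Rightarrow> real) \<Rightarrow> bool" where
  "admissible \<iota> f \<longleftrightarrow>
     f \<in> borel_measurable (lebesgue_on {p. 1 \<le> heis_norm \<iota> p}) \<and>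
     (\<forall>p. 1 < heis_norm \<iota> p \<longrightarrow> horizontally_differentiable_at \<iota> f p)"

end

theory Submission
  imports Defs
begin

text \<open>
  Write \<open>|x|\<close> for the length of the horizontal part, \<open>E\<close> for the horizontal Euler field, \<open>R\<close> for the
  horizontal rotation and \<open>\<rho> = \<surd>(B\<^sup>2 + t\<^sup>2)\<close>, which is comparable to \<open>N\<^sup>2\<close>. The horizontal field
  \<open>V = |x|\<^sup>-\<^sup>2 (- E + (12 / \<rho>) (B E + t R))\<close> satisfies \<open>V N \<ge> c / N\<close>, its squared length is at most
  \<open>288 / |x|\<^sup>2\<close>, and its divergence is at most \<open>(2 - 2 n) / |x|\<^sup>2 + C\<close>. Since the divergence of
  \<open>|f|\<^sup>q exp (- g(N)) V\<close> has integral zero, the integral of \<open>(g'(N) V N + (2 n - 2) / |x|\<^sup>2 - C) |f|\<^sup>q\<close>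
  is bounded by that of \<open>q |f|\<^sup>q\<^sup>-\<^sup>1 |V| |\<nabla>f|\<close>, and Young's inequality absorbs \<open>|V|\<^sup>2 |f|\<^sup>q\<close> into the
  Hardy term \<open>|f|\<^sup>q / |x|\<^sup>2\<close>. The singularity on the vertical axis is regularised by \<open>|x|\<^sup>2 + \<epsilon>\<close>.
  A cutoff in \<open>\<rho>\<close> removes the boundary of the unit ball, near which \<open>g'(N)\<close> is bounded.
\<close>

section \<open>Integration by parts along measure preserving flows\<close>

text \<open>The obstacle is the vertical axis. The horizontal gradient of \<open>N\<close> is at
  most of order \<open>|x| / N\<close>, so a horizontal field with \<open>V N >= c / N\<close> must
  have length of order \<open>1 / |x|\<close>, and Young's inequality then leaves a term
  \<open>|f|^q / |x|^2\<close>. Only a negative divergence of the same order can absorb it. This is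
  what \<open>- E / |x|^2\<close> provides, at the price of decreasing \<open>N\<close>. The other
  part repairs this: \<open>(B E + t R) / \<rho>\<close> is the horizontal gradient of
  \<open>\<rho>\<close> with the anisotropy weights dropped, and divided by \<open>|x|^2\<close> it
  has bounded divergence where \<open>\<rho> >= 1\<close>, because \<open>B <= |x|^2 / 2\<close>.
  The factor 12 comes from two bounds: \<open>E\<close> raises \<open>log N\<close> by at most
  \<open>2 B / \<rho>\<close>, and \<open>(B E + t R) / \<rho>\<close> raises it by at least
  \<open>B / (4 \<rho>)\<close>, which nets \<open>(12 / 4 - 2) B / \<rho>\<close>.
  Differentiability of \<open>f\<close> is assumed only along each field separately, without
  continuity of the derivatives. Hence the divergence is integrated one component at a time, along
  the flow of its own field, a measure preserving shear with straight orbits.\<close>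

locale measure_preserving_flow =
  fixes v :: "'a::euclidean_space \<Rightarrow> 'a"
  assumes continuous_field: "continuous_on UNIV v"
    and field_invariant: "v (p + s *\<^sub>R v p) = v p"
    and distr_flow: "distr lborel borel (\<lambda>p. p + s *\<^sub>R v p) = lborel"
begin

lemma measurable_field [measurable]: "v \<in> borel_measurable borel"
  using continuous_field by (rule borel_measurable_continuous_onI)

text \<open>Functions here are only Lebesgue measurable, so composing them with the flow requires
  preimages of null sets to be null. Invariance of the measure supplies this.\<close>

lemma measurable_flow: "(\<lambda>p. p + s *\<^sub>R v p) \<in> lebesgue \<rightarrow>\<^sub>M lebesgue"
proof (rule completion.measurable_completion2)
  have *: "(\<lambda>p. p + s *\<^sub>R v p) \<in> lborel \<rightarrow>\<^sub>M lborel" by simp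
  then show "(\<lambda>p. p + s *\<^sub>R v p) \<in> lebesgue \<rightarrow>\<^sub>M lborel"
    by (rule measurable_completion)
  have "distr lebesgue lborel (\<lambda>p. p + s *\<^sub>R v p) = distr lborel borel (\<lambda>p. p + s *\<^sub>R v p)"
  proof (rule measure_eqI)
    fix A assume "A \<in> sets (distr lebesgue lborel (\<lambda>p. p + s *\<^sub>R v p))"
    then have A: "A \<in> sets borel" by simp
    have "(\<lambda>p. p + s *\<^sub>R v p) -` A \<in> sets lborel"
      using measurable_sets[OF * , of A] A by simp
    then show "emeasure (distr lebesgue lborel (\<lambda>p. p + s *\<^sub>R v p)) A =
        emeasure (distr lborel borel (\<lambda>p. p + s *\<^sub>R v p)) A"
      using A * by (simp add: emeasure_distr measurable_completion)
  qed simp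
  then show "null_sets lborel \<subseteq> null_sets (distr lebesgue lborel (\<lambda>p. p + s *\<^sub>R v p))"
    by (simp add: distr_flow)
qed

lemma AE_flow:
  assumes "AE p in lborel. P p"
  shows "AE p in lborel. P (p + s *\<^sub>R v p)"
proof (rule AE_distrD[where f = "\<lambda>p. p + s *\<^sub>R v p" and M = lborel and M' = borel])
  show "AE p in distr lborel borel (\<lambda>p. p + s *\<^sub>R v p). P p"
    using assms by (simp only: distr_flow)
qed simp

text \<open>The field is constant along its own lines, so these lines are its integral curves, and a
  derivative at time \<open>s\<close> is a derivative at time 0 from the moved base point.\<close>

lemma has_real_derivative_along_flow:
  assumes "((\<lambda>r. h (p + s *\<^sub>R v p + r *\<^sub>R v (p + s *\<^sub>R v p))) has_real_derivative d) (at 0)"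
  shows "((\<lambda>s. h (p + s *\<^sub>R v p)) has_real_derivative d) (at s)"
proof -
  have "((\<lambda>r. h (p + (r + s) *\<^sub>R v p)) has_real_derivative d) (at 0)"
    using assms by (simp add: field_invariant algebra_simps)
  then show ?thesis
    using DERIV_shift[of "\<lambda>s. h (p + s *\<^sub>R v p)" d 0 s] by simp
qed

text \<open>
  The integral of the derivative along the flow over unit time is \<open>h \<circ> \<Phi>\<^sub>1 - h\<close>, which has integral
  zero; exchanging the integrals, the average over time of the integrals of \<open>h' \<circ> \<Phi>\<^sub>s\<close> vanishes. The
  Henstock-Kurzweil form of the fundamental theorem needs no continuity of \<open>h'\<close>.
\<close>

lemma integral_flow_derivative_eq_0:
  fixes h h' :: "'a \<Rightarrow> real"
  assumes h: "integrable lebesgue h" and h': "integrable lebesgue h'"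
    and D: "\<And>p. ((\<lambda>s. h (p + s *\<^sub>R v p)) has_real_derivative h' p) (at 0)"
  shows "integral\<^sup>L lebesgue h' = 0"
proof -
  \<comment> \<open>Fubini is applied to the Borel representatives \<open>k\<close> and
    \<open>h0\<close>; the exact \<open>h\<close> and \<open>h'\<close> are kept for the fundamental
    theorem on single orbits.\<close>
  obtain k where k[measurable]: "k \<in> borel_measurable borel" and hk: "AE p in lborel. h' p = k p"
    using completion_ex_borel_measurable_real[OF borel_measurable_integrable[OF h']] by auto
  obtain h0 where h0[measurable]: "h0 \<in> borel_measurable borel" and hh0: "AE p in lborel. h p = h0 p"
    using completion_ex_borel_measurable_real[OF borel_measurable_integrable[OF h]] by auto
  have int_eq: "integral\<^sup>L lebesgue h' = integral\<^sup>L lborel k"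
  proof -
    have "integral\<^sup>L lebesgue h' = integral\<^sup>L lebesgue k"
      using hk h' by (intro integral_cong_AE AE_completion) (auto simp: measurable_completion)
    then show ?thesis by (simp add: integral_completion)
  qed
  have intk: "integrable lborel k"
  proof -
    have "integrable lebesgue k"
      using h' hk by (subst integrable_cong_AE[where g=h']) (auto simp: measurable_completion intro!: AE_completion)
    then show ?thesis by (simp add: integrable_completion)
  qed
  have inth0: "integrable lborel h0"
  proof -
    have "integrable lebesgue h0"
      using h hh0 by (subst integrable_cong_AE[where g=h]) (auto simp: measurable_completion intro!: AE_completion)
    then show ?thesis by (simp add: integrable_completion)
  qed
  have comp_int: "integrable lborel (\<lambda>p. u (p + s *\<^sub>R v p))"
      "(LINT p|lborel. u (p + s *\<^sub>R v p)) = integral\<^sup>L lborel u"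
    if u: "integrable lborel u" for u :: "'a \<Rightarrow> real" and s
  proof -
    have um: "u \<in> borel_measurable borel" using u by auto
    have m: "(\<lambda>p. p + s *\<^sub>R v p) \<in> lborel \<rightarrow>\<^sub>M borel" by simp
    show "integrable lborel (\<lambda>p. u (p + s *\<^sub>R v p))"
      using integrable_distr[OF m, of u] u by (simp add: distr_flow)
    show "(LINT p|lborel. u (p + s *\<^sub>R v p)) = integral\<^sup>L lborel u"
      using integral_distr[OF m um] by (simp add: distr_flow)
  qed
  define F where "F = (\<lambda>(s::real) p. indicator {0..1} s * k (p + s *\<^sub>R v p))"
  have Fm[measurable]: "case_prod F \<in> borel_measurable (lborel \<Otimes>\<^sub>M lborel)"
    unfolding F_def by measurable
  have Fint: "integrable (lborel \<Otimes>\<^sub>M lborel) (case_prod F)"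
  proof (rule lborel_pair.Fubini_integrable[OF Fm])
    have "(\<lambda>s. LINT p|lborel. norm (case_prod F (s, p))) = (\<lambda>s. indicator {0..1} s * (LINT p|lborel. \<bar>k p\<bar>))"
      using comp_int(2)[OF integrable_abs[OF intk]] by (auto simp: F_def abs_mult fun_eq_iff)
    moreover have "integrable lborel (\<lambda>s::real. indicator {0..1} s * (LINT p|lborel. \<bar>k p\<bar>))"
      by simp
    ultimately show "integrable lborel (\<lambda>s. LINT p|lborel. norm (case_prod F (s, p)))" by simp
    show "AE s in lborel. integrable lborel (\<lambda>p. case_prod F (s, p))"
      using comp_int(1)[OF intk] by (auto simp: F_def)
  qed
  obtain N0 where N0: "N0 \<in> sets borel" "emeasure lborel N0 = 0" "{p. h' p \<noteq> k p} \<subseteq> N0"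
    using hk by (auto elim!: AE_E)
  have notN: "AE p in lborel. p \<notin> N0"
    using N0 by (simp add: AE_iff_measurable)
  have "AE s in lborel. AE p in lborel. p + s *\<^sub>R v p \<notin> N0"
    using AE_flow[OF notN] by auto
  \<comment> \<open>Each time slice of the bad set is null by invariance. Exchanging the
    quantifiers, almost every orbit meets \<open>N0\<close> only in a null set of times.\<close>
  then have AEN: "AE p in lborel. AE s in lborel. p + s *\<^sub>R v p \<notin> N0"
  proof (subst (asm) lborel_pair.AE_commute)
    show "{x \<in> space (lborel \<Otimes>\<^sub>M lborel). snd x + fst x *\<^sub>R v (snd x) \<notin> N0} \<in> sets (lborel \<Otimes>\<^sub>M lborel)"
      using N0(1) by measurable
  qed
  have "AE p in lborel. integrable lborel (\<lambda>s. F s p)"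
    using lborel_pair.AE_integrable_snd[OF Fint] .
  then have "AE p in lborel. (LINT s|lborel. F s p) = h0 (p + 1 *\<^sub>R v p) - h0 p"
    using AEN hh0 AE_flow[OF hh0, of 1]
  proof eventually_elim
    case (elim p)
    have "((\<lambda>s. h' (p + s *\<^sub>R v p)) has_integral h (p + 1 *\<^sub>R v p) - h (p + 0 *\<^sub>R v p)) {0..1}"
    proof (rule fundamental_theorem_of_calculus)
      fix s :: real
      have "((\<lambda>s. h (p + s *\<^sub>R v p)) has_real_derivative h' (p + s *\<^sub>R v p)) (at s)"
        by (rule has_real_derivative_along_flow) (rule D)
      then show "((\<lambda>s. h (p + s *\<^sub>R v p)) has_vector_derivative h' (p + s *\<^sub>R v p)) (at s within {0..1})"
        by (simp add: has_real_derivative_iff_has_vector_derivative has_vector_derivative_at_within)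
    qed simp
    moreover have "AE s in lborel. s \<in> {0..1} \<longrightarrow> h' (p + s *\<^sub>R v p) = k (p + s *\<^sub>R v p)"
      using elim(2)
    proof eventually_elim
      case (elim s)
      then show ?case using N0(3) by blast
    qed
    ultimately have "((\<lambda>s. k (p + s *\<^sub>R v p)) has_integral h0 (p + 1 *\<^sub>R v p) - h0 p) {0..1}"
      using elim(3,4) by (subst (asm) has_integral_AE) auto
    then have "((\<lambda>s. if s \<in> {0..1} then k (p + s *\<^sub>R v p) else 0) has_integral h0 (p + 1 *\<^sub>R v p) - h0 p) UNIV"
      by (simp only: has_integral_restrict_UNIV)
    also have "(\<lambda>s. if s \<in> {0..1} then k (p + s *\<^sub>R v p) else 0) = (\<lambda>s. F s p)"
      by (auto simp: F_def fun_eq_iff)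
    \<comment> \<open>Since \<open>k\<close> is Lebesgue integrable along this orbit, the gauge
      integral just computed is its Lebesgue integral.\<close>
    finally show ?case
      using has_integral_integral_lborel[OF elim(1)] has_integral_unique by blast
  qed
  then have "(LINT p|lborel. LINT s|lborel. F s p) = (LINT p|lborel. h0 (p + 1 *\<^sub>R v p) - h0 p)"
    by (intro integral_cong_AE) auto
  also have "\<dots> = 0"
    using comp_int[OF inth0, of 1] inth0 by simp
  also have "(LINT p|lborel. LINT s|lborel. F s p) = (LINT s|lborel. LINT p|lborel. F s p)"
    by (rule lborel_pair.Fubini_integral[OF Fint])
  also have "\<dots> = integral\<^sup>L lborel k"
    using comp_int(2)[OF intk] by (simp add: F_def)
  finally show ?thesis using int_eq by simp
qed

text \<open>A pointwise limit of difference quotients with steps \<open>1 / (i + 1)\<close>.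
  Measurability of \<open>h\<close> is required on the whole space because the moved point may leave
  \<open>S\<close>; functions given on \<open>S\<close> are therefore extended by zero before
  use.\<close>

lemma borel_measurable_flow_derivative:
  fixes h h' :: "'a \<Rightarrow> real"
  assumes h: "h \<in> borel_measurable lebesgue" and S: "S \<in> sets lebesgue"
    and D: "\<And>p. p \<in> S \<Longrightarrow> ((\<lambda>s. h (p + s *\<^sub>R v p)) has_real_derivative h' p) (at 0)"
  shows "h' \<in> borel_measurable (lebesgue_on S)"
proof (rule borel_measurable_LIMSEQ_real)
  fix p assume "p \<in> space (lebesgue_on S)"
  then have "((\<lambda>s. (h (p + s *\<^sub>R v p) - h p) / s) \<longlongrightarrow> h' p) (at 0)"
    using D[of p] S by (simp add: DERIV_def space_restrict_space)
  moreover have "filterlim (\<lambda>i. inverse (real (Suc i))) (at 0) sequentially"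
    using LIMSEQ_inverse_real_of_nat by (auto simp: filterlim_at)
  ultimately show "(\<lambda>i. (h (p + inverse (real (Suc i)) *\<^sub>R v p) - h p) / inverse (real (Suc i))) \<longlonglongrightarrow> h' p"
    by (rule filterlim_compose)
next
  fix i
  have "(\<lambda>p. h (p + inverse (real (Suc i)) *\<^sub>R v p)) \<in> borel_measurable lebesgue"
    using measurable_compose[OF measurable_flow h] .
  then show "(\<lambda>p. (h (p + inverse (real (Suc i)) *\<^sub>R v p) - h p) / inverse (real (Suc i)))
      \<in> borel_measurable (lebesgue_on S)"
    using h by (intro measurable_restrict_space1) auto
qed

end

text \<open>For fixed \<open>x\<close> and \<open>y\<close> the shear is a translation in the last
  variable, so Tonelli reduces it to the line; the remaining shift by \<open>(a, b, 0)\<close> is a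
  translation of the whole space.\<close>

lemma distr_shift_last:
  fixes l :: "'a::euclidean_space \<Rightarrow> 'b::euclidean_space \<Rightarrow> real"
  assumes l: "case_prod l \<in> borel_measurable borel"
  shows "distr lborel borel (\<lambda>(x, y, t). (x + a, y + b, t + l x y)) = lborel"
proof -
  have [measurable]: "case_prod l \<in> borel_measurable (borel \<Otimes>\<^sub>M borel)"
    using l by (simp add: borel_prod)
  have m1[measurable]: "(\<lambda>(x::'a, y::'b, t::real). (x, y, t + l x y)) \<in> borel \<rightarrow>\<^sub>M borel"
    unfolding borel_prod[symmetric] by measurable
  have shift: "(\<integral>\<^sup>+t. u (t + c) \<partial>lborel) = (\<integral>\<^sup>+t. u t \<partial>lborel)"
    if "u \<in> borel_measurable borel" for u :: "real \<Rightarrow> ennreal" and c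
    using that nn_integral_distr[of "(+) c" lborel borel u] lborel_distr_plus[of c]
    by (simp add: add.commute)
  have "distr lborel borel (\<lambda>(x::'a, y::'b, t::real). (x, y, t + l x y)) = lborel"
  proof (rule measure_eqI)
    fix A assume "A \<in> sets (distr lborel borel (\<lambda>(x::'a, y::'b, t::real). (x, y, t + l x y)))"
    then have A: "A \<in> sets borel" by simp
    define u :: "'a \<times> 'b \<times> real \<Rightarrow> ennreal" where "u = indicator A"
    have u: "u \<in> borel_measurable borel" using A by (simp add: u_def)
    then have u'[measurable]: "u \<in> borel_measurable (lborel \<Otimes>\<^sub>M (lborel \<Otimes>\<^sub>M lborel))"
      by (simp add: lborel_prod)
    have iterate: "(\<integral>\<^sup>+p. w p \<partial>(lborel \<Otimes>\<^sub>M (lborel \<Otimes>\<^sub>M lborel))) =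
        (\<integral>\<^sup>+x. \<integral>\<^sup>+y. \<integral>\<^sup>+t. w (x, y, t) \<partial>lborel \<partial>lborel \<partial>lborel)"
      if [measurable]: "w \<in> borel_measurable (lborel \<Otimes>\<^sub>M (lborel \<Otimes>\<^sub>M lborel))"
      for w :: "'a \<times> 'b \<times> real \<Rightarrow> ennreal"
    proof -
      have "(\<integral>\<^sup>+p. w p \<partial>(lborel \<Otimes>\<^sub>M (lborel \<Otimes>\<^sub>M lborel))) = (\<integral>\<^sup>+x. \<integral>\<^sup>+q. w (x, q) \<partial>(lborel \<Otimes>\<^sub>M lborel) \<partial>lborel)"
        using that lborel.nn_integral_fst[of w "lborel :: 'a measure"] by (simp add: lborel_prod)
      also have "\<dots> = (\<integral>\<^sup>+x. \<integral>\<^sup>+y. \<integral>\<^sup>+t. w (x, y, t) \<partial>lborel \<partial>lborel \<partial>lborel)"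
        by (intro nn_integral_cong lborel.nn_integral_fst[symmetric]) measurable
      finally show ?thesis .
    qed
    have "emeasure (distr lborel borel (\<lambda>(x, y, t). (x, y, t + l x y))) A =
        (\<integral>\<^sup>+p. u p \<partial>distr lborel borel (\<lambda>(x, y, t). (x, y, t + l x y)))"
      using A by (simp add: u_def)
    also have "\<dots> = (\<integral>\<^sup>+p. u (case p of (x, y, t) \<Rightarrow> (x, y, t + l x y)) \<partial>lborel)"
      using u m1 by (subst nn_integral_distr) auto
    also have "\<dots> = (\<integral>\<^sup>+p. u (case p of (x, y, t) \<Rightarrow> (x, y, t + l x y)) \<partial>(lborel \<Otimes>\<^sub>M (lborel \<Otimes>\<^sub>M lborel)))"
      by (simp add: lborel_prod)
    also have "\<dots> = (\<integral>\<^sup>+x. \<integral>\<^sup>+y. \<integral>\<^sup>+t. u (x, y, t + l x y) \<partial>lborel \<partial>lborel \<partial>lborel)"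
      by (subst iterate) simp_all
    also have "\<dots> = (\<integral>\<^sup>+x. \<integral>\<^sup>+y. \<integral>\<^sup>+t. u (x, y, t) \<partial>lborel \<partial>lborel \<partial>lborel)"
      by (intro nn_integral_cong shift) measurable
    also have "\<dots> = (\<integral>\<^sup>+p. u p \<partial>(lborel \<Otimes>\<^sub>M (lborel \<Otimes>\<^sub>M lborel)))"
      by (subst iterate) simp_all
    also have "\<dots> = emeasure lborel A"
      using A by (simp add: lborel_prod u_def)
    finally show "emeasure (distr lborel borel (\<lambda>(x, y, t). (x, y, t + l x y))) A = emeasure lborel A" .
  qed simp
  then have "distr lborel borel ((+) (a, b, 0) \<circ> (\<lambda>(x, y, t). (x, y, t + l x y))) = lborel"
    using lborel_distr_plus[of "(a, b, 0::real)"]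
    by (subst distr_distr[symmetric, where N = borel]) auto
  also have "(+) (a, b, 0) \<circ> (\<lambda>(x, y, t). (x, y, t + l x y)) = (\<lambda>(x, y, t). (x + a, y + b, t + l x y))"
    by (auto simp: fun_eq_iff)
  finally show ?thesis .
qed

section \<open>The norm and the horizontal fields\<close>

text \<open>
  The fields \<open>X\<^sub>j\<close> and \<open>X\<^sub>n\<^sub>+\<^sub>j\<close> are indexed by \<open>(True, j)\<close> and \<open>(False, j)\<close>. Up to the weight, the
  conjugate coordinate is the \<open>t\<close>-component of the field.
\<close>

definition hfield :: "'n::finite \<Rightarrow> bool \<times> 'n \<Rightarrow> 'n heis \<Rightarrow> 'n heis" where
  "hfield \<iota> k = (if fst k then X_vec \<iota> (snd k) else Y_vec \<iota> (snd k))"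

definition hcoord :: "bool \<times> 'n::finite \<Rightarrow> 'n heis \<Rightarrow> real" where
  "hcoord k = (\<lambda>(x, y, t). if fst k then x $ snd k else y $ snd k)"

definition conj_coord :: "bool \<times> 'n::finite \<Rightarrow> 'n heis \<Rightarrow> real" where
  "conj_coord k = (\<lambda>(x, y, t). if fst k then - y $ snd k else x $ snd k)"

definition vert :: "'n::finite heis \<Rightarrow> real" where
  "vert p = snd (snd p)"

abbreviation weight :: "'n::finite \<Rightarrow> bool \<times> 'n \<Rightarrow> real" where "weight \<iota> k \<equiv> aniso \<iota> (snd k)"

definition hsq :: "'n::finite heis \<Rightarrow> real" where
  "hsq p = (\<Sum>k\<in>UNIV. (hcoord k p)\<^sup>2)"

definition heis_rho :: "'n::finite \<Rightarrow> 'n heis \<Rightarrow> real" where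
  "heis_rho \<iota> p = sqrt ((heis_B \<iota> p)\<^sup>2 + (vert p)\<^sup>2)"

lemma sum_bool_pair:
  fixes F :: "bool \<times> 'n::finite \<Rightarrow> 'a::comm_monoid_add"
  shows "(\<Sum>k\<in>UNIV. F k) = (\<Sum>j\<in>UNIV. F (True, j) + F (False, j))"
proof -
  have "(\<Sum>k\<in>UNIV. F k) = (\<Sum>b\<in>UNIV. \<Sum>j\<in>UNIV. F (b, j))"
    by (simp add: sum.cartesian_product)
  then show ?thesis
    by (simp add: UNIV_bool sum.distrib add.commute)
qed

lemma hcoord_flow: "hcoord k' (p + s *\<^sub>R hfield \<iota> k p) = hcoord k' p + (if k' = k then s else 0)"
  by (cases p; cases k; cases k')
    (auto simp: hcoord_def hfield_def X_vec_def Y_vec_def axis_def)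

lemma conj_coord_flow: "conj_coord k (p + s *\<^sub>R hfield \<iota> k p) = conj_coord k p"
  by (cases p; cases k) (auto simp: conj_coord_def hfield_def X_vec_def Y_vec_def axis_def)

lemma vert_flow: "vert (p + s *\<^sub>R hfield \<iota> k p) = vert p + s * (weight \<iota> k * conj_coord k p)"
  by (cases p; cases k) (auto simp: vert_def conj_coord_def hfield_def X_vec_def Y_vec_def)

text \<open>\<open>E\<close> and \<open>R\<close> are orthogonal in every coordinate plane, so a
  weight that depends only on the plane is harmless.\<close>

lemma sum_hcoord_conj_coord:
  fixes w :: "'n::finite \<Rightarrow> real"
  shows "(\<Sum>k\<in>UNIV. w (snd k) * (hcoord k p * conj_coord k p)) = 0"
  by (cases p) (simp add: sum_bool_pair hcoord_def conj_coord_def)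

lemma sum_conj_coord_sq:
  fixes w :: "'n::finite \<Rightarrow> real"
  shows "(\<Sum>k\<in>UNIV. w (snd k) * (conj_coord k p)\<^sup>2) = (\<Sum>k\<in>UNIV. w (snd k) * (hcoord k p)\<^sup>2)"
  by (cases p) (simp add: sum_bool_pair hcoord_def conj_coord_def algebra_simps)

lemma heis_B_eq_sum: "heis_B \<iota> p = (\<Sum>k\<in>UNIV. weight \<iota> k / 2 * (hcoord k p)\<^sup>2)"
proof (cases p)
  case (fields x y t)
  have "(\<Sum>k\<in>UNIV. weight \<iota> k / 2 * (hcoord k p)\<^sup>2) = (\<Sum>j\<in>UNIV. aniso \<iota> j / 2 * ((x $ j)\<^sup>2 + (y $ j)\<^sup>2))"
    by (simp add: sum_bool_pair hcoord_def fields algebra_simps)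
  also have "\<dots> = aniso \<iota> \<iota> / 2 * ((x $ \<iota>)\<^sup>2 + (y $ \<iota>)\<^sup>2) +
      (\<Sum>j\<in>UNIV - {\<iota>}. aniso \<iota> j / 2 * ((x $ j)\<^sup>2 + (y $ j)\<^sup>2))"
    by (subst sum.remove[of UNIV \<iota>]) auto
  also have "(\<Sum>j\<in>UNIV - {\<iota>}. aniso \<iota> j / 2 * ((x $ j)\<^sup>2 + (y $ j)\<^sup>2)) =
      (\<Sum>j\<in>UNIV - {\<iota>}. 1 / 2 * ((x $ j)\<^sup>2 + (y $ j)\<^sup>2))"
    by (intro sum.cong) (auto simp: aniso_def)
  finally show ?thesis
    by (simp add: fields heis_B_def aniso_def sum_distrib_left add_divide_distrib)
qed

lemma heis_A_eq_hsq: "heis_A \<iota> p = hsq p / 2"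
proof (cases p)
  case (fields x y t)
  have "hsq p = (\<Sum>j\<in>UNIV. (x $ j)\<^sup>2 + (y $ j)\<^sup>2)"
    by (simp add: hsq_def sum_bool_pair hcoord_def fields)
  also have "\<dots> = (x $ \<iota>)\<^sup>2 + (y $ \<iota>)\<^sup>2 + (\<Sum>j\<in>UNIV - {\<iota>}. (x $ j)\<^sup>2 + (y $ j)\<^sup>2)"
    by (subst sum.remove[of UNIV \<iota>]) auto
  finally show ?thesis
    by (simp add: fields heis_A_def add_divide_distrib)
qed

lemma sum_weight_hcoord_sq: "(\<Sum>k\<in>UNIV. weight \<iota> k * (hcoord k p)\<^sup>2) = 2 * heis_B \<iota> p"
  by (simp add: heis_B_eq_sum sum_distrib_left)

lemma hsq_nonneg: "0 \<le> hsq p"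
  by (simp add: hsq_def sum_nonneg)

lemma two_heis_B_le_hsq: "2 * heis_B \<iota> p \<le> hsq p"
  unfolding sum_weight_hcoord_sq[symmetric] hsq_def
  by (intro sum_mono) (simp add: mult_left_le_one_le aniso_def)

lemma hsq_le_four_heis_B: "hsq p \<le> 4 * heis_B \<iota> p"
proof -
  have "hsq p / 2 \<le> 2 * heis_B \<iota> p"
    unfolding sum_weight_hcoord_sq[symmetric] hsq_def sum_divide_distrib
    by (intro sum_mono) (simp add: aniso_def)
  then show ?thesis by simp
qed

lemma heis_B_nonneg: "0 \<le> heis_B \<iota> p"
  using hsq_nonneg[of p] hsq_le_four_heis_B[of p \<iota>] by linarith

lemma heis_B_le_rho: "heis_B \<iota> p \<le> heis_rho \<iota> p"
  unfolding heis_rho_def by (rule real_le_rsqrt) simp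

lemma abs_vert_le_rho: "\<bar>vert p\<bar> \<le> heis_rho \<iota> p"
  unfolding heis_rho_def by (rule real_le_rsqrt) simp

lemma heis_rho_sq: "(heis_rho \<iota> p)\<^sup>2 = (heis_B \<iota> p)\<^sup>2 + (vert p)\<^sup>2"
  by (simp add: heis_rho_def)

lemma heis_rho_nonneg: "0 \<le> heis_rho \<iota> p"
  by (simp add: heis_rho_def)

text \<open>
  With \<open>\<rho> = \<surd>(B\<^sup>2 + t\<^sup>2)\<close> one has \<open>AB + t\<^sup>2 + A\<rho> = (A - B + \<rho>)(B + \<rho>)\<close>, so the norm is a product of
  powers of \<open>\<rho>\<close>, \<open>A - B + \<rho>\<close> and \<open>B + \<rho>\<close>.
\<close>

definition log_norm :: "'n::finite \<Rightarrow> 'n heis \<Rightarrow> real" where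
  "log_norm \<iota> p = (let n = real CARD('n); B = heis_B \<iota> p; \<rho> = heis_rho \<iota> p in
     ln \<rho> / (2 * n) + (1 / 2 - 1 / (4 * n)) * ln (hsq p / 2 - B + \<rho>) - ln (B + \<rho>) / (4 * n))"

lemma heis_norm_eq_exp:
  fixes p :: "'n::finite heis"
  assumes "0 < heis_rho \<iota> p"
  shows "heis_norm \<iota> p = exp (log_norm \<iota> p)"
proof -
  let ?n = "real CARD('n)" and ?B = "heis_B \<iota> p" and ?r = "heis_rho \<iota> p" and ?c = "hsq p / 2 - heis_B \<iota> p"
  have n: "?n > 0" by simp
  have c: "0 < ?c + ?r" and B: "0 < ?B + ?r"
    using assms two_heis_B_le_hsq[of \<iota> p] heis_B_nonneg[of \<iota> p] by linarith+
  have "p \<noteq> 0"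
    using assms by (auto simp: heis_rho_def heis_B_def vert_def zero_prod_def)
  moreover have "heis_A \<iota> p * ?B + (vert p)\<^sup>2 + heis_A \<iota> p * ?r = (?c + ?r) * (?B + ?r)"
    using heis_rho_sq[of \<iota> p] by (simp add: heis_A_eq_hsq power2_eq_square field_simps)
  ultimately have "heis_norm \<iota> p = (?r\<^sup>2) powr (1 / (4 * ?n)) *
      ((?c + ?r) * (?B + ?r)) powr (1 / 2 - 1 / (4 * ?n)) / (?B + ?r) powr (1 / 2)"
    unfolding heis_norm_def Let_def by (simp add: heis_rho_def vert_def)
  also have "\<dots> = exp (1 / (4 * ?n) * ln (?r\<^sup>2)) *
      exp ((1 / 2 - 1 / (4 * ?n)) * ln ((?c + ?r) * (?B + ?r))) / exp (1 / 2 * ln (?B + ?r))"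
    using assms c B unfolding powr_def by auto
  also have "\<dots> = exp (1 / (4 * ?n) * ln (?r\<^sup>2) + (1 / 2 - 1 / (4 * ?n)) * ln ((?c + ?r) * (?B + ?r)) - 1 / 2 * ln (?B + ?r))"
    by (simp only: exp_add exp_diff)
  also have "1 / (4 * ?n) * ln (?r\<^sup>2) + (1 / 2 - 1 / (4 * ?n)) * ln ((?c + ?r) * (?B + ?r)) - 1 / 2 * ln (?B + ?r)
      = log_norm \<iota> p"
  proof -
    have l: "ln (?r\<^sup>2) = 2 * ln ?r" "ln ((?c + ?r) * (?B + ?r)) = ln (?c + ?r) + ln (?B + ?r)"
      using assms c B by (auto simp: ln_mult ln_realpow)
    show ?thesis
      unfolding l log_norm_def Let_def
      by (simp add: algebra_simps diff_divide_distrib add_divide_distrib)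
  qed
  finally show ?thesis .
qed

text \<open>Both \<open>A - B + \<rho>\<close> and \<open>B + \<rho>\<close> lie between
  \<open>\<rho>\<close> and \<open>2 \<rho>\<close>, and the exponents in \<open>N^2\<close>, namely
  \<open>4 m\<close>, \<open>1 - 2 m\<close> and \<open>- 2 m\<close>, add up to 1. The factor 2
  occurs with exponent at most 1 in absolute value.\<close>

lemma heis_norm_sq_bounds:
  assumes "0 < heis_rho \<iota> p"
  shows "heis_rho \<iota> p / 2 \<le> (heis_norm \<iota> p)\<^sup>2" "(heis_norm \<iota> p)\<^sup>2 \<le> 2 * heis_rho \<iota> p"
proof -
  let ?B = "heis_B \<iota> p" and ?r = "heis_rho \<iota> p" and ?c = "hsq p / 2 - heis_B \<iota> p"
  define m where "m = 1 / (4 * real CARD('a))"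
  have m: "0 \<le> m" "m \<le> 1 / 4" by (auto simp: m_def)
  have c: "?r \<le> ?c + ?r" "?c + ?r \<le> 2 * ?r" and B: "?r \<le> ?B + ?r" "?B + ?r \<le> 2 * ?r"
    using assms two_heis_B_le_hsq[of \<iota> p] heis_B_nonneg[of \<iota> p] heis_B_le_rho[of \<iota> p]
      hsq_le_four_heis_B[of p \<iota>] by linarith+
  define x y z where "x = ln ?r" and "y = ln (?c + ?r)" and "z = ln (?B + ?r)"
  have l2: "ln (2 * ?r) = ln 2 + x" using assms by (simp add: ln_mult x_def)
  have y: "x \<le> y" "y \<le> ln 2 + x" and z: "x \<le> z" "z \<le> ln 2 + x"
    using c B assms l2[symmetric] by (auto simp: x_def y_def z_def)
  have ln2: "0 \<le> ln (2::real)" by simp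
  have L: "2 * log_norm \<iota> p = 4 * m * x + (1 - 2 * m) * y - 2 * m * z"
    by (simp add: log_norm_def Let_def x_def y_def z_def m_def field_simps)
  have sq: "(heis_norm \<iota> p)\<^sup>2 = exp (2 * log_norm \<iota> p)"
    using assms by (simp add: heis_norm_eq_exp exp_double)
  have "2 * log_norm \<iota> p \<le> 4 * m * x + (1 - 2 * m) * (ln 2 + x) - 2 * m * x"
    unfolding L using m y z by (intro add_mono diff_mono mult_left_mono) auto
  also have "\<dots> \<le> ln 2 + x" using m ln2 by (simp add: algebra_simps)
  finally have "(heis_norm \<iota> p)\<^sup>2 \<le> exp (ln 2 + x)" by (simp add: sq)
  then show "(heis_norm \<iota> p)\<^sup>2 \<le> 2 * heis_rho \<iota> p" using assms by (simp add: exp_add x_def)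
  have "2 * log_norm \<iota> p \<ge> 4 * m * x + (1 - 2 * m) * x - 2 * m * (ln 2 + x)"
    unfolding L using m y z by (intro add_mono diff_mono mult_left_mono) auto
  moreover have "4 * m * x + (1 - 2 * m) * x - 2 * m * (ln 2 + x) \<ge> x - ln 2"
    using mult_right_mono[of "2 * m" 1 "ln 2"] m ln2 by (simp add: algebra_simps)
  ultimately have "(heis_norm \<iota> p)\<^sup>2 \<ge> exp (x - ln 2)" by (simp add: sq)
  then show "heis_rho \<iota> p / 2 \<le> (heis_norm \<iota> p)\<^sup>2" using assms by (simp add: exp_diff x_def)
qed

text \<open>Moving along a field changes one horizontal coordinate and \<open>t\<close>, while its
  coefficients depend only on the conjugate coordinate, which stays fixed.\<close>

lemma measure_preserving_flow_hfield: "measure_preserving_flow (hfield \<iota> k)"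
proof
  show "continuous_on UNIV (hfield \<iota> k)"
    unfolding hfield_def X_vec_def Y_vec_def case_prod_beta
    by (cases "fst k") (auto intro!: continuous_intros)
  show "hfield \<iota> k (p + s *\<^sub>R hfield \<iota> k p) = hfield \<iota> k p" for p s
    by (cases p; cases k) (auto simp: hfield_def X_vec_def Y_vec_def axis_def)
  show "distr lborel borel (\<lambda>p. p + s *\<^sub>R hfield \<iota> k p) = lborel" for s
  proof (cases "fst k")
    case True
    have eq: "(\<lambda>p. p + s *\<^sub>R hfield \<iota> k p) =
        (\<lambda>(x, y, t). (x + s *\<^sub>R axis (snd k) 1, y + 0, t + s * (- weight \<iota> k * y $ snd k)))"
      using True by (auto simp: hfield_def X_vec_def)
    show ?thesis unfolding eq
      by (rule distr_shift_last) (auto simp: case_prod_beta intro!: borel_measurable_continuous_onI continuous_intros)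
  next
    case False
    have eq: "(\<lambda>p. p + s *\<^sub>R hfield \<iota> k p) =
        (\<lambda>(x, y, t). (x + 0, y + s *\<^sub>R axis (snd k) 1, t + s * (weight \<iota> k * x $ snd k)))"
      using False by (auto simp: hfield_def Y_vec_def)
    show ?thesis unfolding eq
      by (rule distr_shift_last) (auto simp: case_prod_beta intro!: borel_measurable_continuous_onI continuous_intros)
  qed
qed

section \<open>Horizontal derivatives and the Hardy field\<close>

abbreviation has_hderiv :: "'n::finite \<Rightarrow> bool \<times> 'n \<Rightarrow> ('n heis \<Rightarrow> real) \<Rightarrow> real \<Rightarrow> 'n heis \<Rightarrow> bool" where
  "has_hderiv \<iota> k u d p \<equiv> ((\<lambda>s. u (p + s *\<^sub>R hfield \<iota> k p)) has_real_derivative d) (at 0)"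

lemma has_hderiv_hcoord: "has_hderiv \<iota> k (hcoord k') (if k' = k then 1 else 0) p"
  unfolding hcoord_flow by (auto intro!: derivative_eq_intros)

lemma has_hderiv_conj_coord: "has_hderiv \<iota> k (conj_coord k) 0 p"
  unfolding conj_coord_flow by (auto intro!: derivative_eq_intros)

lemma has_hderiv_vert: "has_hderiv \<iota> k vert (weight \<iota> k * conj_coord k p) p"
  unfolding vert_flow by (auto intro!: derivative_eq_intros)

lemma has_hderiv_weighted_sum:
  "has_hderiv \<iota> k (\<lambda>p. \<Sum>k'\<in>UNIV. w k' * (hcoord k' p)\<^sup>2) (2 * w k * hcoord k p) p"
proof -
  have "has_hderiv \<iota> k (\<lambda>p. \<Sum>k'\<in>UNIV. w k' * (hcoord k' p)\<^sup>2)
      (\<Sum>k'\<in>UNIV. w k' * (2 * hcoord k' p * (if k' = k then 1 else 0))) p"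
    by (intro DERIV_sum) (auto intro!: derivative_eq_intros has_hderiv_hcoord)
  moreover have "(\<Sum>k'\<in>UNIV. w k' * (2 * hcoord k' p * (if k' = k then 1 else 0))) =
      (\<Sum>k'\<in>UNIV. if k' = k then 2 * w k' * hcoord k' p else 0)"
    by (intro sum.cong) auto
  then have "(\<Sum>k'\<in>UNIV. w k' * (2 * hcoord k' p * (if k' = k then 1 else 0))) = 2 * w k * hcoord k p"
    by simp
  ultimately show ?thesis by (rule DERIV_cong)
qed

lemma has_hderiv_hsq: "has_hderiv \<iota> k hsq (2 * hcoord k p) p"
  using has_hderiv_weighted_sum[where w = "\<lambda>_. 1"] by (simp add: hsq_def[abs_def])

lemma has_hderiv_heis_B: "has_hderiv \<iota> k (heis_B \<iota>) (weight \<iota> k * hcoord k p) p"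
  using has_hderiv_weighted_sum[where w = "\<lambda>k. weight \<iota> k / 2"] by (simp add: heis_B_eq_sum)

definition rho_deriv :: "'n::finite \<Rightarrow> bool \<times> 'n \<Rightarrow> 'n heis \<Rightarrow> real" where
  "rho_deriv \<iota> k p =
     weight \<iota> k * (heis_B \<iota> p * hcoord k p + vert p * conj_coord k p) / heis_rho \<iota> p"

lemma has_hderiv_heis_rho:
  assumes "0 < heis_rho \<iota> p"
  shows "has_hderiv \<iota> k (heis_rho \<iota>) (rho_deriv \<iota> k p) p"
proof -
  have pos: "0 < (heis_B \<iota> p)\<^sup>2 + (vert p)\<^sup>2"
    using assms by (simp add: heis_rho_def)
  have "has_hderiv \<iota> k (\<lambda>p. (heis_B \<iota> p)\<^sup>2 + (vert p)\<^sup>2)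
      (2 * heis_B \<iota> p * (weight \<iota> k * hcoord k p) + 2 * vert p * (weight \<iota> k * conj_coord k p)) p"
    by (auto intro!: derivative_eq_intros has_hderiv_heis_B has_hderiv_vert)
  moreover have "((\<lambda>x. sqrt x) has_real_derivative inverse (sqrt ((heis_B \<iota> p)\<^sup>2 + (vert p)\<^sup>2)) / 2)
      (at ((heis_B \<iota> (p + 0 *\<^sub>R hfield \<iota> k p))\<^sup>2 + (vert (p + 0 *\<^sub>R hfield \<iota> k p))\<^sup>2))"
    using DERIV_real_sqrt[OF pos] by simp
  ultimately have "has_hderiv \<iota> k (\<lambda>p. sqrt ((heis_B \<iota> p)\<^sup>2 + (vert p)\<^sup>2))
      (inverse (sqrt ((heis_B \<iota> p)\<^sup>2 + (vert p)\<^sup>2)) / 2 *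
        (2 * heis_B \<iota> p * (weight \<iota> k * hcoord k p) + 2 * vert p * (weight \<iota> k * conj_coord k p))) p"
    by (rule DERIV_chain2[rotated])
  moreover have "inverse c / 2 * (2 * a * (w * x) + 2 * b * (w * y)) = w * (a * x + b * y) / c"
    for a b c w x y :: real
    by (cases "c = 0") (simp_all add: field_simps)
  ultimately show ?thesis
    unfolding heis_rho_def rho_deriv_def by (simp only:)
qed

definition log_norm_deriv :: "'n::finite \<Rightarrow> bool \<times> 'n \<Rightarrow> 'n heis \<Rightarrow> real" where
  "log_norm_deriv \<iota> k p = (let n = real CARD('n); B = heis_B \<iota> p; \<rho> = heis_rho \<iota> p in
     rho_deriv \<iota> k p / (2 * n * \<rho>)
     + (1 / 2 - 1 / (4 * n)) * ((1 - weight \<iota> k) * hcoord k p + rho_deriv \<iota> k p) / (hsq p / 2 - B + \<rho>)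
     - (weight \<iota> k * hcoord k p + rho_deriv \<iota> k p) / (4 * n * (B + \<rho>)))"

lemma has_hderiv_log_norm:
  assumes "0 < heis_rho \<iota> p"
  shows "has_hderiv \<iota> k (log_norm \<iota>) (log_norm_deriv \<iota> k p) p"
proof -
  have "0 < hsq p / 2 - heis_B \<iota> p + heis_rho \<iota> p" "0 < heis_B \<iota> p + heis_rho \<iota> p"
    using assms two_heis_B_le_hsq[of \<iota> p] heis_B_nonneg[of \<iota> p] by linarith+
  then have c: "0 < hsq p / 2 - heis_B \<iota> p + heis_rho \<iota> p" and B: "0 < heis_B \<iota> p + heis_rho \<iota> p"
    by auto
  have hln: "has_hderiv \<iota> k (\<lambda>p. ln (u p)) (d / u p) p" if "has_hderiv \<iota> k u d p" "0 < u p" for u d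
    using DERIV_chain2[OF DERIV_ln_divide, of "\<lambda>s. u (p + s *\<^sub>R hfield \<iota> k p)" 0 d] that by simp
  note \<rho> = has_hderiv_heis_rho[OF assms]
  note c' = DERIV_add[OF DERIV_diff[OF DERIV_cdivide[OF has_hderiv_hsq] has_hderiv_heis_B] \<rho>]
  note * = DERIV_diff[OF DERIV_add[OF DERIV_cdivide[OF hln[OF \<rho> assms]] DERIV_cmult[OF hln[OF c' c]]]
    DERIV_cdivide[OF hln[OF DERIV_add[OF has_hderiv_heis_B \<rho>] B]]]
  show ?thesis
    unfolding log_norm_def log_norm_deriv_def Let_def
    by (rule DERIV_cong[OF *]) (simp add: algebra_simps)
qed

text \<open>
  The components of the horizontal field \<open>(|x|\<^sup>2 + \<epsilon>)\<^sup>-\<^sup>1 (- E + (12 / \<rho>) (B E + t R))\<close>, where \<open>E\<close> is the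
  horizontal Euler field and \<open>R\<close> the horizontal rotation. The part \<open>- E / |x|\<^sup>2\<close> yields the Hardy term
  that pays for the singularity on the vertical axis; the rest dominates its effect on the norm.
\<close>

definition hardy_coef :: "real \<Rightarrow> 'n::finite \<Rightarrow> bool \<times> 'n \<Rightarrow> 'n heis \<Rightarrow> real" where
  "hardy_coef \<epsilon> \<iota> k p = ((12 * (heis_B \<iota> p / heis_rho \<iota> p) - 1) * hcoord k p
     + 12 * (vert p / heis_rho \<iota> p) * conj_coord k p) / (hsq p + \<epsilon>)"

text \<open>Only the derivative of the component \<open>k\<close> along the field \<open>k\<close>
  is recorded. Summed over \<open>k\<close> these give the full divergence, since each horizontal
  field is itself divergence free.\<close>

definition hardy_coef_deriv :: "real \<Rightarrow> 'n::finite \<Rightarrow> bool \<times> 'n \<Rightarrow> 'n heis \<Rightarrow> real" where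
  "hardy_coef_deriv \<epsilon> \<iota> k p = (let B = heis_B \<iota> p; \<rho> = heis_rho \<iota> p; a = weight \<iota> k; t = vert p;
       \<xi> = hcoord k p; \<eta> = conj_coord k p in
     (12 * (B / \<rho>) - 1 + \<xi> * 12 * (a * \<xi> / \<rho> - B * rho_deriv \<iota> k p / \<rho>\<^sup>2)
        + \<eta> * 12 * (a * \<eta> / \<rho> - t * rho_deriv \<iota> k p / \<rho>\<^sup>2)) / (hsq p + \<epsilon>)
     - 2 * \<xi> * ((12 * (B / \<rho>) - 1) * \<xi> + 12 * (t / \<rho>) * \<eta>) / (hsq p + \<epsilon>)\<^sup>2)"

lemma has_hderiv_hardy_coef:
  assumes "0 < heis_rho \<iota> p" "0 < \<epsilon>"
  shows "has_hderiv \<iota> k (hardy_coef \<epsilon> \<iota> k) (hardy_coef_deriv \<epsilon> \<iota> k p) p"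
proof -
  have den: "hsq p + \<epsilon> \<noteq> 0" using assms hsq_nonneg[of p] by linarith
  have aux: "(a * d - u * b) / (d * d) = a / d - b * u / d\<^sup>2" if "d \<noteq> 0" for a b d u :: real
    using that by (simp add: field_simps power2_eq_square)
  have quot: "has_hderiv \<iota> k (\<lambda>p. u p / heis_rho \<iota> p) (d / heis_rho \<iota> p - u p * rho_deriv \<iota> k p / (heis_rho \<iota> p)\<^sup>2) p"
    if "has_hderiv \<iota> k u d p" for u d
    using DERIV_divide[OF that has_hderiv_heis_rho[OF assms(1)]] assms(1)
    by (simp add: diff_divide_distrib power2_eq_square)
  have num: "has_hderiv \<iota> k (\<lambda>p. (12 * (heis_B \<iota> p / heis_rho \<iota> p) - 1) * hcoord k p
      + 12 * (vert p / heis_rho \<iota> p) * conj_coord k p)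
     (12 * (heis_B \<iota> p / heis_rho \<iota> p) - 1
       + hcoord k p * 12 * (weight \<iota> k * hcoord k p / heis_rho \<iota> p - heis_B \<iota> p * rho_deriv \<iota> k p / (heis_rho \<iota> p)\<^sup>2)
        + conj_coord k p * 12 * (weight \<iota> k * conj_coord k p / heis_rho \<iota> p - vert p * rho_deriv \<iota> k p / (heis_rho \<iota> p)\<^sup>2)) p"
  proof -
    note B = DERIV_diff[OF DERIV_cmult[OF quot[OF has_hderiv_heis_B]] DERIV_const]
    note t = DERIV_cmult[OF quot[OF has_hderiv_vert]]
    have "has_hderiv \<iota> k (hcoord k) 1 p" using has_hderiv_hcoord[where k = k and k' = k] by simp
    note * = DERIV_add[OF DERIV_mult[OF B this] DERIV_mult[OF t has_hderiv_conj_coord]]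
    show ?thesis by (rule DERIV_cong[OF *]) (simp add: algebra_simps)
  qed
  have "has_hderiv \<iota> k (\<lambda>p. hsq p + \<epsilon>) (2 * hcoord k p) p"
    by (auto intro!: derivative_eq_intros has_hderiv_hsq)
  from DERIV_divide[OF num this] den show ?thesis
    unfolding hardy_coef_def hardy_coef_deriv_def Let_def by (simp only: aux scaleR_zero_left add_0_right not_False_eq_True)
qed

section \<open>Divergence and length of the Hardy field, and its action on \<open>\<rho>\<close> and
  \<open>log N\<close>\<close>

text \<open>One normal form for all sums over the horizontal directions: cross terms cancel by
  orthogonality of \<open>E\<close> and \<open>R\<close>, and squares of conjugate coordinates sum
  to the same as squares of coordinates. The \<open>expand\<close> facts below bring summands into
  this shape, with explicit zeros for the absent terms.\<close>

lemma sum_horizontal: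
  fixes p :: "'n::finite heis"
  shows "(\<Sum>k\<in>UNIV. c1 + c2 * (hcoord k p)\<^sup>2 + c3 * (weight \<iota> k * (hcoord k p)\<^sup>2)
      + c4 * (weight \<iota> k * (conj_coord k p)\<^sup>2) + c5 * (weight \<iota> k * (hcoord k p * conj_coord k p))
      + c6 * (hcoord k p * conj_coord k p) + c7 * (conj_coord k p)\<^sup>2) =
    2 * real CARD('n) * c1 + (c2 + c7) * hsq p + 2 * (c3 + c4) * heis_B \<iota> p"
  using sum_hcoord_conj_coord[of "\<lambda>_. 1" p] sum_hcoord_conj_coord[of "aniso \<iota>" p]
    sum_conj_coord_sq[of "\<lambda>_. 1" p] sum_conj_coord_sq[of "aniso \<iota>" p]
  by (simp add: sum.distrib sum_distrib_left[symmetric] sum_weight_hcoord_sq hsq_def[symmetric] algebra_simps)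

text \<open>With \<open>r = |x|^2\<close>, the part \<open>- E / (r + \<epsilon>)\<close>
  contributes \<open>- 2 n / (r + \<epsilon>) + 2 r / (r + \<epsilon>)^2\<close>, which gives the
  first term. Every contribution of the other part carries the factor
  \<open>B / (\<rho> (r + \<epsilon>))\<close>, which is at most 1 because \<open>2 B <= r\<close>
  and \<open>\<rho> >= 1\<close>.\<close>

lemma hardy_field_divergence:
  fixes p :: "'n::finite heis"
  assumes "1 \<le> heis_rho \<iota> p" "0 < \<epsilon>"
  shows "(\<Sum>k\<in>UNIV. hardy_coef_deriv \<epsilon> \<iota> k p) \<le>
    (2 - 2 * real CARD('n)) / (hsq p + \<epsilon>) + 12 * (2 * real CARD('n) + 2)"
proof -
  let ?n = "real CARD('n)"
  define B t \<rho> r where "B = heis_B \<iota> p" and "t = vert p" and "\<rho> = heis_rho \<iota> p" and "r = hsq p"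
  define i where "i = 1 / \<rho>"
  define \<Lambda> where "\<Lambda> = 1 / (r + \<epsilon>)"
  have \<rho>: "1 \<le> \<rho>" and r: "0 \<le> r" "2 * B \<le> r" and B: "0 \<le> B" and \<rho>2: "\<rho>\<^sup>2 = B\<^sup>2 + t\<^sup>2"
    using assms(1) hsq_nonneg[of p] two_heis_B_le_hsq[of \<iota> p] heis_B_nonneg[of \<iota> p] heis_rho_sq[of \<iota> p]
    by (auto simp: B_def t_def \<rho>_def r_def)
  have \<Lambda>: "0 < \<Lambda>" "r * \<Lambda> \<le> 1" using r assms(2) by (auto simp: \<Lambda>_def)
  have i: "0 < i" "i \<le> 1" "i * \<rho> = 1" using \<rho> by (auto simp: i_def)
  have div: "x / \<rho> = x * i" "x / \<rho>\<^sup>2 = x * i\<^sup>2" "x / (r + \<epsilon>) = x * \<Lambda>" "x / (r + \<epsilon>)\<^sup>2 = x * \<Lambda>\<^sup>2" for x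
    by (simp_all add: i_def \<Lambda>_def power_divide)
  have expand: "hardy_coef_deriv \<epsilon> \<iota> k p = \<Lambda> * (12 * B * i - 1) + (- 2 * \<Lambda>\<^sup>2 * (12 * B * i - 1)) * (hcoord k p)\<^sup>2
      + \<Lambda> * 12 * (i - B\<^sup>2 * i ^ 3) * (weight \<iota> k * (hcoord k p)\<^sup>2)
      + \<Lambda> * 12 * (i - t\<^sup>2 * i ^ 3) * (weight \<iota> k * (conj_coord k p)\<^sup>2)
      + (- \<Lambda> * 24 * B * t * i ^ 3) * (weight \<iota> k * (hcoord k p * conj_coord k p))
      + (- 2 * \<Lambda>\<^sup>2 * 12 * t * i) * (hcoord k p * conj_coord k p) + 0 * (conj_coord k p)\<^sup>2" for k
    unfolding hardy_coef_deriv_def rho_deriv_def Let_def B_def[symmetric] t_def[symmetric] \<rho>_def[symmetric]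
      r_def[symmetric] div
    by (simp only: power2_eq_square power3_eq_cube) algebra
  have "(\<Sum>k\<in>UNIV. hardy_coef_deriv \<epsilon> \<iota> k p) = 2 * ?n * (\<Lambda> * (12 * B * i - 1))
      + (- 2 * \<Lambda>\<^sup>2 * (12 * B * i - 1)) * r
      + 2 * (\<Lambda> * 12 * (i - B\<^sup>2 * i ^ 3) + \<Lambda> * 12 * (i - t\<^sup>2 * i ^ 3)) * B"
    unfolding expand sum_horizontal by (simp add: r_def B_def)
  \<comment> \<open>The relation \<open>\<rho>^2 = B^2 + t^2\<close> collapses the derivatives of
    the two unit factors \<open>B / \<rho>\<close> and \<open>t / \<rho>\<close> into a single
    term.\<close>
  also have "(\<Lambda> * 12 * (i - B\<^sup>2 * i ^ 3) + \<Lambda> * 12 * (i - t\<^sup>2 * i ^ 3)) = \<Lambda> * 12 * i"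
  proof -
    have "(B\<^sup>2 + t\<^sup>2) * i ^ 3 = i * (i * \<rho>)\<^sup>2" unfolding \<rho>2[symmetric] by (simp add: power2_eq_square power3_eq_cube)
    then have "(B\<^sup>2 + t\<^sup>2) * i ^ 3 = i" using i by simp
    moreover have "\<Lambda> * 12 * (i - B\<^sup>2 * i ^ 3) + \<Lambda> * 12 * (i - t\<^sup>2 * i ^ 3) =
        \<Lambda> * 12 * (2 * i - (B\<^sup>2 + t\<^sup>2) * i ^ 3)"
      by (simp add: algebra_simps)
    ultimately show ?thesis by simp
  qed
  also have "2 * ?n * (\<Lambda> * (12 * B * i - 1)) + (- 2 * \<Lambda>\<^sup>2 * (12 * B * i - 1)) * r + 2 * (\<Lambda> * 12 * i) * B
      = (2 * (r * \<Lambda>) - 2 * ?n) * \<Lambda> + (2 * ?n + 2) * 12 * (\<Lambda> * B * i) - 24 * (r * \<Lambda>) * (\<Lambda> * B * i)"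
    by (simp add: algebra_simps power2_eq_square)
  also have "\<dots> \<le> (2 - 2 * ?n) * \<Lambda> + (2 * ?n + 2) * 12 * 1 - 0"
  proof (intro diff_mono add_mono mult_right_mono mult_left_mono)
    have "\<Lambda> * (2 * B) \<le> \<Lambda> * r" "0 \<le> \<Lambda> * B" using \<Lambda> r B by (auto intro: mult_left_mono)
    moreover have "\<Lambda> * r \<le> 1" using \<Lambda> by (simp add: mult.commute)
    ultimately have "\<Lambda> * B \<le> 1" by linarith
    then have "(\<Lambda> * B) * i \<le> 1 * 1" using i \<Lambda> B by (intro mult_mono) auto
    then show "\<Lambda> * B * i \<le> 1" by simp
    show "0 \<le> 24 * (r * \<Lambda>) * (\<Lambda> * B * i)" using r \<Lambda> B i by simp
  qed (use \<Lambda> in auto)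
  finally show ?thesis by (simp add: \<Lambda>_def r_def mult.commute)
qed

text \<open>\<open>E\<close> and \<open>R\<close> are orthogonal, both of length \<open>|x|\<close>,
  and their multipliers \<open>m\<close> and \<open>l\<close> are bounded by 12; hence
  \<open>288 = 12^2 + 12^2\<close>.\<close>

lemma sum_hardy_coef_sq:
  fixes p :: "'n::finite heis"
  assumes "0 < heis_rho \<iota> p" "0 < \<epsilon>"
  shows "(\<Sum>k\<in>UNIV. (hardy_coef \<epsilon> \<iota> k p)\<^sup>2) \<le> 288 / (hsq p + \<epsilon>)"
proof -
  define B t \<rho> r where "B = heis_B \<iota> p" and "t = vert p" and "\<rho> = heis_rho \<iota> p" and "r = hsq p"
  define \<Lambda> where "\<Lambda> = 1 / (r + \<epsilon>)"
  define m l where "m = 12 * (B / \<rho>) - 1" and "l = 12 * (t / \<rho>)"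
  have \<rho>: "0 < \<rho>" "B \<le> \<rho>" "\<bar>t\<bar> \<le> \<rho>" and r: "0 \<le> r" and B: "0 \<le> B"
    using assms(1) hsq_nonneg[of p] heis_B_le_rho[of \<iota> p] abs_vert_le_rho[of p \<iota>] heis_B_nonneg[of \<iota> p]
    by (auto simp: B_def t_def \<rho>_def r_def)
  have \<Lambda>: "0 < \<Lambda>" "r * \<Lambda> \<le> 1" using r assms(2) by (auto simp: \<Lambda>_def)
  have "\<bar>m\<bar> \<le> 12" "\<bar>l\<bar> \<le> 12" using \<rho> B by (auto simp: m_def l_def abs_le_iff field_simps)
  then have ml: "m\<^sup>2 + l\<^sup>2 \<le> 288"
    using power_mono[of "\<bar>m\<bar>" 12 2] power_mono[of "\<bar>l\<bar>" 12 2] by simp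
  have expand: "(hardy_coef \<epsilon> \<iota> k p)\<^sup>2 = 0 + (\<Lambda>\<^sup>2 * m\<^sup>2) * (hcoord k p)\<^sup>2 + 0 * (weight \<iota> k * (hcoord k p)\<^sup>2)
      + 0 * (weight \<iota> k * (conj_coord k p)\<^sup>2) + 0 * (weight \<iota> k * (hcoord k p * conj_coord k p))
      + (2 * \<Lambda>\<^sup>2 * m * l) * (hcoord k p * conj_coord k p) + (\<Lambda>\<^sup>2 * l\<^sup>2) * (conj_coord k p)\<^sup>2" for k
    unfolding hardy_coef_def B_def[symmetric] t_def[symmetric] \<rho>_def[symmetric]
      r_def[symmetric] m_def[symmetric] l_def[symmetric] \<Lambda>_def
    by (simp add: power2_eq_square divide_inverse) (simp add: algebra_simps)
  have "(\<Sum>k\<in>UNIV. (hardy_coef \<epsilon> \<iota> k p)\<^sup>2) = (\<Lambda>\<^sup>2 * m\<^sup>2 + \<Lambda>\<^sup>2 * l\<^sup>2) * r"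
    unfolding expand sum_horizontal by (simp add: r_def)
  also have "\<dots> = ((m\<^sup>2 + l\<^sup>2) * (r * \<Lambda>)) * \<Lambda>"
    by (simp add: power2_eq_square algebra_simps)
  also have "\<dots> \<le> (288 * 1) * \<Lambda>"
    using \<Lambda> ml r by (intro mult_right_mono mult_mono) auto
  finally show ?thesis by (simp add: \<Lambda>_def r_def)
qed

text \<open>Controls the derivative of a cutoff in \<open>\<rho>\<close>. The field is singular at
  the axis, but the factor \<open>2 B\<close> from the gradient of \<open>\<rho>\<close> cancels
  \<open>|x|^2\<close>, leaving at most \<open>12 + 12\<close>.\<close>

lemma abs_hardy_field_rho:
  fixes p :: "'n::finite heis"
  assumes "0 < heis_rho \<iota> p" "0 < \<epsilon>"
  shows "\<bar>\<Sum>k\<in>UNIV. hardy_coef \<epsilon> \<iota> k p * rho_deriv \<iota> k p\<bar> \<le> 24"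
proof -
  define B t \<rho> r where "B = heis_B \<iota> p" and "t = vert p" and "\<rho> = heis_rho \<iota> p" and "r = hsq p"
  define \<Lambda> where "\<Lambda> = 1 / (r + \<epsilon>)"
  define m l where "m = 12 * (B / \<rho>) - 1" and "l = 12 * (t / \<rho>)"
  have \<rho>: "0 < \<rho>" "B \<le> \<rho>" "\<bar>t\<bar> \<le> \<rho>" and r: "0 \<le> r" "2 * B \<le> r" and B: "0 \<le> B"
    using assms(1) hsq_nonneg[of p] heis_B_le_rho[of \<iota> p] abs_vert_le_rho[of p \<iota>] heis_B_nonneg[of \<iota> p]
      two_heis_B_le_hsq[of \<iota> p]
    by (auto simp: B_def t_def \<rho>_def r_def)
  have \<Lambda>: "0 < \<Lambda>" "r * \<Lambda> \<le> 1" using r assms(2) by (auto simp: \<Lambda>_def)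
  have ml: "\<bar>m\<bar> \<le> 12" "\<bar>l\<bar> \<le> 12" using \<rho> B by (auto simp: m_def l_def abs_le_iff field_simps)
  have expand: "hardy_coef \<epsilon> \<iota> k p * rho_deriv \<iota> k p = 0 + 0 * (hcoord k p)\<^sup>2
      + (\<Lambda> * m * B / \<rho>) * (weight \<iota> k * (hcoord k p)\<^sup>2)
      + (\<Lambda> * l * t / \<rho>) * (weight \<iota> k * (conj_coord k p)\<^sup>2)
      + (\<Lambda> * (m * t + l * B) / \<rho>) * (weight \<iota> k * (hcoord k p * conj_coord k p))
      + 0 * (hcoord k p * conj_coord k p) + 0 * (conj_coord k p)\<^sup>2" for k
    unfolding hardy_coef_def rho_deriv_def B_def[symmetric] t_def[symmetric] \<rho>_def[symmetric]
      r_def[symmetric] m_def[symmetric] l_def[symmetric] \<Lambda>_def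
    by (simp add: power2_eq_square divide_inverse) (simp add: algebra_simps)
  have "(\<Sum>k\<in>UNIV. hardy_coef \<epsilon> \<iota> k p * rho_deriv \<iota> k p) = 2 * (\<Lambda> * m * B / \<rho> + \<Lambda> * l * t / \<rho>) * B"
    unfolding expand sum_horizontal by (simp add: B_def)
  also have "\<dots> = (2 * B * \<Lambda>) * (m * (B / \<rho>) + l * (t / \<rho>))"
    by (simp add: algebra_simps)
  finally have eq: "(\<Sum>k\<in>UNIV. hardy_coef \<epsilon> \<iota> k p * rho_deriv \<iota> k p) =
      (2 * B * \<Lambda>) * (m * (B / \<rho>) + l * (t / \<rho>))" .
  have "2 * B * \<Lambda> \<le> r * \<Lambda>" using r \<Lambda> by (intro mult_right_mono) auto
  then have b: "2 * B * \<Lambda> \<le> 1" "0 \<le> 2 * B * \<Lambda>" using \<Lambda> B by (linarith, simp)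
  have "\<bar>m * (B / \<rho>)\<bar> \<le> 12 * 1" "\<bar>l * (t / \<rho>)\<bar> \<le> 12 * 1"
    unfolding abs_mult using ml \<rho> B by (intro mult_mono; simp)+
  then have "\<bar>m * (B / \<rho>) + l * (t / \<rho>)\<bar> \<le> 24" by linarith
  then have "(2 * B * \<Lambda>) * \<bar>m * (B / \<rho>) + l * (t / \<rho>)\<bar> \<le> 1 * 24" using b by (intro mult_mono) auto
  then show ?thesis unfolding eq abs_mult[of "2 * B * \<Lambda>"] abs_of_nonneg[OF b(2)] by simp
qed

text \<open>With \<open>b = B / \<rho>\<close>, the loss caused by \<open>- E\<close> is at most
  \<open>2 b\<close> and the gain of the other part is at least \<open>12 b / 4\<close>. The
  constant 12 is chosen so that \<open>b\<close> remains.\<close>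

lemma hardy_field_log_norm:
  fixes p :: "'n::finite heis"
  assumes "0 < heis_rho \<iota> p" "0 < \<epsilon>"
  shows "heis_B \<iota> p / heis_rho \<iota> p / (hsq p + \<epsilon>) \<le> (\<Sum>k\<in>UNIV. hardy_coef \<epsilon> \<iota> k p * log_norm_deriv \<iota> k p)"
proof -
  define n where "n = real CARD('n)"
  have n: "1 \<le> n" by (simp add: n_def Suc_leI)
  define B t \<rho> r where "B = heis_B \<iota> p" and "t = vert p" and "\<rho> = heis_rho \<iota> p" and "r = hsq p"
  define \<Lambda> where "\<Lambda> = 1 / (r + \<epsilon>)"
  define m l where "m = 12 * (B / \<rho>) - 1" and "l = 12 * (t / \<rho>)"
  define c where "c = r / 2 - B"
  have \<rho>: "0 < \<rho>" "B \<le> \<rho>" and r: "0 \<le> r" and B: "0 \<le> B" and c: "0 \<le> c" "c \<le> B"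
    and \<rho>2: "\<rho>\<^sup>2 = B\<^sup>2 + t\<^sup>2"
    using assms(1) hsq_nonneg[of p] heis_B_le_rho[of \<iota> p] heis_B_nonneg[of \<iota> p]
      two_heis_B_le_hsq[of \<iota> p] hsq_le_four_heis_B[of p \<iota>] heis_rho_sq[of \<iota> p]
    by (auto simp: B_def t_def \<rho>_def r_def c_def)
  have \<Lambda>: "0 < \<Lambda>" using r assms(2) by (auto simp: \<Lambda>_def)
  define \<kappa> where "\<kappa> = 1 / 2 - 1 / (4 * n)"
  \<comment> \<open>The derivative of \<open>log_norm\<close> is regrouped: \<open>P\<close>
    multiplies the derivative of \<open>\<rho>\<close>, \<open>\<kappa> * C\<close> that of
    \<open>A - B\<close>, and \<open>- D\<close> that of \<open>B\<close>.\<close>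
  define C D where "C = 1 / (c + \<rho>)" and "D = 1 / (4 * n * (B + \<rho>))"
  define P where "P = 1 / (2 * n * \<rho>) + \<kappa> * C - D"
  have \<kappa>: "1 / 4 \<le> \<kappa>" "\<kappa> \<le> 1 / 2" using n by (auto simp: \<kappa>_def field_simps)
  have CD: "0 < C" "C \<le> 1 / \<rho>" "1 / (2 * \<rho>) \<le> C" "0 < D" "D \<le> 1 / (4 * n * \<rho>)"
  proof -
    have "0 < 4 * n * (B + \<rho>)" "4 * n * \<rho> \<le> 4 * n * (B + \<rho>)" "0 < 4 * n * \<rho>" using \<rho> n B by auto
    then show "0 < D" "D \<le> 1 / (4 * n * \<rho>)" unfolding D_def
      by (simp_all only: zero_less_divide_1_iff) (rule frac_le; simp)
    have "0 < c + \<rho>" "\<rho> \<le> c + \<rho>" "c + \<rho> \<le> 2 * \<rho>" using \<rho> c by auto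
    then show "0 < C" "C \<le> 1 / \<rho>" "1 / (2 * \<rho>) \<le> C" using \<rho> unfolding C_def by (linarith | intro divide_pos_pos divide_left_mono mult_pos_pos zero_less_one)+
  qed
  have L: "log_norm_deriv \<iota> k p = P * rho_deriv \<iota> k p + \<kappa> * C * ((1 - weight \<iota> k) * hcoord k p) - D * (weight \<iota> k * hcoord k p)" for k
    unfolding log_norm_deriv_def Let_def n_def[symmetric] \<kappa>_def[symmetric] r_def[symmetric] B_def[symmetric]
      \<rho>_def[symmetric] c_def[symmetric] P_def C_def D_def
    by (simp add: algebra_simps add_divide_distrib diff_divide_distrib)
  have expand: "hardy_coef \<epsilon> \<iota> k p * log_norm_deriv \<iota> k p = 0 + (\<Lambda> * m * \<kappa> * C) * (hcoord k p)\<^sup>2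
      + (\<Lambda> * m * (P * B / \<rho> - \<kappa> * C - D)) * (weight \<iota> k * (hcoord k p)\<^sup>2)
      + (\<Lambda> * l * P * t / \<rho>) * (weight \<iota> k * (conj_coord k p)\<^sup>2)
      + (\<Lambda> * (m * P * t / \<rho> + l * P * B / \<rho> - l * \<kappa> * C - l * D)) * (weight \<iota> k * (hcoord k p * conj_coord k p))
      + (\<Lambda> * l * \<kappa> * C) * (hcoord k p * conj_coord k p) + 0 * (conj_coord k p)\<^sup>2" for k
    unfolding L hardy_coef_def rho_deriv_def B_def[symmetric] t_def[symmetric] \<rho>_def[symmetric]
      r_def[symmetric] m_def[symmetric] l_def[symmetric] \<Lambda>_def
    by (simp add: power2_eq_square divide_inverse) (simp add: algebra_simps)
  \<comment> \<open>\<open>e\<close> is \<open>E log N\<close>; the corresponding value of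
    \<open>R log N\<close> is \<open>2 * P * t * B / \<rho>\<close>.\<close>
  define e where "e = 2 * P * B\<^sup>2 / \<rho> + 2 * \<kappa> * C * c - 2 * D * B"
  have "(\<Sum>k\<in>UNIV. hardy_coef \<epsilon> \<iota> k p * log_norm_deriv \<iota> k p) =
      (\<Lambda> * m * \<kappa> * C) * r + 2 * (\<Lambda> * m * (P * B / \<rho> - \<kappa> * C - D) + \<Lambda> * l * P * t / \<rho>) * B"
    unfolding expand sum_horizontal by (simp add: B_def r_def)
  also have "\<dots> = \<Lambda> * (m * e + l * (2 * P * t * B / \<rho>))"
  proof -
    have "r = 2 * (c + B)" by (simp add: c_def)
    then show ?thesis unfolding e_def by (simp add: power2_eq_square divide_inverse) (simp add: algebra_simps)
  qed
  also have "m * e + l * (2 * P * t * B / \<rho>) = 12 * (B / \<rho>) * (e + 2 * P * t\<^sup>2 / \<rho>) - e"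
    by (simp add: m_def l_def power2_eq_square divide_inverse) (simp add: algebra_simps)
  finally have eq: "(\<Sum>k\<in>UNIV. hardy_coef \<epsilon> \<iota> k p * log_norm_deriv \<iota> k p) =
      \<Lambda> * (12 * (B / \<rho>) * (e + 2 * P * t\<^sup>2 / \<rho>) - e)" .
  have P_low: "(1 / 2 + 1 / (4 * n)) / 2 \<le> P * \<rho>"
  proof -
    have "P * \<rho> = 1 / (2 * n) + \<kappa> * (C * \<rho>) - D * \<rho>"
      using \<rho> by (simp add: P_def algebra_simps)
    moreover have "1 / 2 \<le> C * \<rho>" "D * \<rho> \<le> 1 / (4 * n)" using CD \<rho> n by (auto simp: field_simps)
    moreover have "\<kappa> * (1 / 2) \<le> \<kappa> * (C * \<rho>)" using \<kappa> calculation by (intro mult_left_mono) auto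
    moreover have "1 / (2 * n) + \<kappa> * (1 / 2) - 1 / (4 * n) = (1 / 2 + 1 / (4 * n)) / 2" by (simp add: \<kappa>_def field_simps)
    ultimately show ?thesis by linarith
  qed
  have P_up: "P * \<rho> \<le> 1 / 2 + 1 / (4 * n)"
  proof -
    have "P * \<rho> = 1 / (2 * n) + \<kappa> * (C * \<rho>) - D * \<rho>"
      using \<rho> by (simp add: P_def algebra_simps)
    moreover have "C * \<rho> \<le> 1" "0 \<le> D * \<rho>" using CD \<rho> by (auto simp: field_simps)
    moreover have "\<kappa> * (C * \<rho>) \<le> \<kappa> * 1" using \<kappa> calculation by (intro mult_left_mono) auto
    moreover have "1 / (2 * n) + \<kappa> * 1 = 1 / 2 + 1 / (4 * n)" by (simp add: \<kappa>_def field_simps)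
    ultimately show ?thesis by linarith
  qed
  define b where "b = B / \<rho>"
  have b: "0 \<le> b" "b \<le> 1" using B \<rho> by (auto simp: b_def)
  have DB: "2 * D * B \<le> b / (2 * n)" "0 \<le> 2 * D * B"
    using mult_right_mono[OF CD(5) B] CD(4) B by (auto simp: b_def field_simps)
  have Cc: "2 * \<kappa> * C * c \<le> 2 * \<kappa> * b" "0 \<le> 2 * \<kappa> * C * c"
  proof -
    have "C * c \<le> 1 / \<rho> * B" using CD c \<rho> by (intro mult_mono) auto
    then have "2 * \<kappa> * (C * c) \<le> 2 * \<kappa> * b" using \<kappa> by (intro mult_left_mono) (auto simp: b_def)
    then show "2 * \<kappa> * C * c \<le> 2 * \<kappa> * b" by (simp only: mult.assoc)
    show "0 \<le> 2 * \<kappa> * C * c" using \<kappa> CD c by simp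
  qed
  \<comment> \<open>The upper bound for \<open>P * \<rho>\<close> and \<open>\<kappa>\<close> are
    \<open>1 / 2 + 1 / (4 n)\<close> and \<open>1 / 2 - 1 / (4 n)\<close>, so the dimension cancels
    in the sum.\<close>
  have "e \<le> 2 * b"
  proof -
    have "2 * P * B\<^sup>2 / \<rho> = 2 * ((P * \<rho>) * (b * b))" using \<rho> by (simp add: b_def power2_eq_square field_simps)
    also have "\<dots> \<le> 2 * ((1 / 2 + 1 / (4 * n)) * (b * 1))"
      using P_up b n by (intro mult_left_mono mult_mono) auto
    finally have "e \<le> 2 * ((1 / 2 + 1 / (4 * n)) * b) + 2 * \<kappa> * b" using Cc DB unfolding e_def by linarith
    also have "\<dots> = 2 * b" by (simp add: \<kappa>_def algebra_simps)
    finally show ?thesis .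
  qed
  \<comment> \<open>The two terms with \<open>P\<close> combine to \<open>2 * (P * \<rho>)\<close>,
    at least \<open>1 / 2 + x\<close> with \<open>x = 1 / (4 n)\<close>. The negative term costs at
    most \<open>2 x\<close>, and \<open>x <= 1 / 4\<close>.\<close>
  moreover have "1 / 4 \<le> e + 2 * P * t\<^sup>2 / \<rho>"
  proof -
    have PB: "2 * P * B\<^sup>2 / \<rho> + 2 * P * t\<^sup>2 / \<rho> = 2 * (P * \<rho>)"
    proof -
      have "2 * P * B\<^sup>2 / \<rho> + 2 * P * t\<^sup>2 / \<rho> = 2 * P * (B\<^sup>2 + t\<^sup>2) / \<rho>"
        by (simp only: add_divide_distrib distrib_left)
      then show ?thesis unfolding \<rho>2[symmetric] using \<rho> by (simp add: power2_eq_square)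
    qed
    define x where "x = 1 / (4 * n)"
    have "x \<le> 1 / 4" "b / (2 * n) \<le> 2 * x" using b n by (auto simp: x_def field_simps)
    moreover have "(1 / 2 + x) / 2 \<le> P * \<rho>" using P_low by (simp only: x_def)
    ultimately have "1 / 4 \<le> 2 * (P * \<rho>) + 2 * \<kappa> * C * c - 2 * D * B"
      using DB(1) Cc(2) by argo
    also have "\<dots> = e + 2 * P * t\<^sup>2 / \<rho>" using PB unfolding e_def by linarith
    finally show ?thesis .
  qed
  then have "12 * b * (1 / 4) \<le> 12 * b * (e + 2 * P * t\<^sup>2 / \<rho>)" using b by (intro mult_left_mono) auto
  ultimately have "b \<le> 12 * b * (e + 2 * P * t\<^sup>2 / \<rho>) - e" by linarith
  then have "\<Lambda> * b \<le> \<Lambda> * (12 * b * (e + 2 * P * t\<^sup>2 / \<rho>) - e)" using \<Lambda> by (intro mult_left_mono) auto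
  then show ?thesis unfolding eq by (simp add: b_def \<Lambda>_def B_def \<rho>_def r_def mult.commute)
qed

section \<open>Elementary inequalities and continuity\<close>

text \<open>At zeros of \<open>f\<close> the power is still differentiable: the difference quotient
  at 0 has size \<open>|h|^(q - 1)\<close>, which tends to 0 because \<open>q > 1\<close>.\<close>

lemma DERIV_abs_powr:
  fixes x q :: real
  assumes "1 < q"
  shows "((\<lambda>x. \<bar>x\<bar> powr q) has_real_derivative q * \<bar>x\<bar> powr (q - 1) * sgn x) (at x)"
proof (cases x "0::real" rule: linorder_cases)
  case less
  have "((\<lambda>x. (- x) powr q) has_real_derivative q * (- x) powr (q - 1) * - 1) (at x)"
    using less DERIV_fun_powr[of uminus "-1" x q] by (auto intro!: derivative_eq_intros)
  then have "((\<lambda>x. (- x) powr q) has_real_derivative q * \<bar>x\<bar> powr (q - 1) * sgn x) (at x)"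
    using less by simp
  then show ?thesis
    by (rule has_field_derivative_transform_within_open[where S = "{..<0}"]) (use less in auto)
next
  case greater
  then have "((\<lambda>x. x powr q) has_real_derivative q * \<bar>x\<bar> powr (q - 1) * sgn x) (at x)"
    using has_real_derivative_powr[of x q] by simp
  then show ?thesis
    by (rule has_field_derivative_transform_within_open[where S = "{0<..}"]) (use greater in auto)
next
  case equal
  have "((\<lambda>h. \<bar>h\<bar> powr (q - 1)) \<longlongrightarrow> \<bar>0\<bar> powr (q - 1)) (at (0::real))"
    using assms by (intro tendsto_powr2 tendsto_intros) auto
  then have lim: "((\<lambda>h. \<bar>h\<bar> powr (q - 1)) \<longlongrightarrow> 0) (at (0::real))"
    by simp
  have "((\<lambda>h::real. \<bar>h\<bar> powr q / h) \<longlongrightarrow> 0) (at 0)"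
    by (rule Lim_null_comparison[OF _ lim])
      (auto simp: eventually_at_filter powr_diff abs_divide)
  then show ?thesis using equal assms by (simp add: has_field_derivative_iff)
qed

text \<open>A crude Young inequality: replace the smaller of the two bases by the larger
  one.\<close>

lemma powr_mult_le_add_powr:
  fixes a b q s :: real
  assumes "0 \<le> a" "0 \<le> b" "0 \<le> s" "s \<le> q"
  shows "a powr (q - s) * b powr s \<le> a powr q + b powr q"
proof (cases "a = 0 \<or> b = 0")
  case False
  then have ab: "0 < a" "0 < b" using assms by auto
  show ?thesis
  proof (cases "b \<le> a")
    case True
    have "a powr (q - s) * b powr s \<le> a powr (q - s) * a powr s"
      using True ab assms by (intro mult_left_mono powr_mono2) auto
    also have "\<dots> = a powr q" using ab by (simp add: powr_add[symmetric])
    finally show ?thesis by (simp add: add_increasing2)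
  next
    case False
    have "a powr (q - s) * b powr s \<le> b powr (q - s) * b powr s"
      using False ab assms by (intro mult_right_mono powr_mono2) auto
    also have "\<dots> = b powr q" using ab by (simp add: powr_add[symmetric])
    finally show ?thesis by (simp add: add_increasing)
  qed
qed auto

text \<open>After division by \<open>a^q\<close> this is a completed square in \<open>V\<close> and
  \<open>z = b / a\<close>. The coefficient \<open>1 / 288\<close> matches the bound on the squared
  length of the Hardy field, so the first term becomes exactly
  \<open>1 / (|x|^2 + \<epsilon>)\<close>; then \<open>72 = 288 / 4\<close>. The condition
  \<open>q >= 2\<close> enters through \<open>a^(q - 2) b^2\<close>.\<close>

lemma young_type_bound:
  fixes a b q V :: real
  assumes "0 \<le> a" "0 \<le> b" "0 \<le> V" "2 \<le> q"
  shows "q * a powr (q - 1) * b * V \<le> V\<^sup>2 / 288 * a powr q + 72 * q\<^sup>2 * (a powr q + b powr q)"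
proof (cases "a = 0")
  case False
  then have a: "0 < a" using assms by auto
  define z where "z = b / a"
  have "0 \<le> (V / 288 - q * z / 2)\<^sup>2 * 288" by simp
  also have "\<dots> = V\<^sup>2 / 288 + 72 * q\<^sup>2 * z\<^sup>2 - q * z * V"
    by (simp add: power2_eq_square algebra_simps)
  finally have "q * z * V \<le> V\<^sup>2 / 288 + 72 * q\<^sup>2 * z\<^sup>2" by simp
  then have "a powr q * (q * z * V) \<le> a powr q * (V\<^sup>2 / 288 + 72 * q\<^sup>2 * z\<^sup>2)"
    by (rule mult_left_mono) simp
  moreover have "a powr q * (q * z * V) = q * a powr (q - 1) * b * V"
    using a by (simp add: z_def powr_diff field_simps)
  moreover have "a powr q * z\<^sup>2 \<le> a powr q + b powr q"
  proof -
    have "a powr q * z\<^sup>2 = a powr (q - 2) * b\<^sup>2"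
      using a by (simp add: z_def powr_diff power_divide)
    also have "\<dots> \<le> a powr q + b powr q"
      using powr_mult_le_add_powr[of a b 2 q] assms by (cases "b = 0") auto
    finally show ?thesis .
  qed
  then have "72 * q\<^sup>2 * (a powr q * z\<^sup>2) \<le> 72 * q\<^sup>2 * (a powr q + b powr q)"
    by (intro mult_left_mono) auto
  moreover have "a powr q * (V\<^sup>2 / 288 + 72 * q\<^sup>2 * z\<^sup>2) = V\<^sup>2 / 288 * a powr q + 72 * q\<^sup>2 * (a powr q * z\<^sup>2)"
    by (simp add: algebra_simps)
  ultimately show ?thesis by linarith
qed (use assms in simp)

section \<open>Continuity away from the origin, and compact shells\<close>

lemma continuous_on_hcoord [continuous_intros]: "continuous_on S (hcoord k)"
  unfolding hcoord_def case_prod_beta by (cases "fst k") (auto intro!: continuous_intros)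

lemma continuous_on_conj_coord [continuous_intros]: "continuous_on S (conj_coord k)"
  unfolding conj_coord_def case_prod_beta by (cases "fst k") (auto intro!: continuous_intros)

lemma continuous_on_vert [continuous_intros]: "continuous_on S vert"
  unfolding vert_def by (intro continuous_intros)

lemma continuous_on_hsq [continuous_intros]: "continuous_on S hsq"
  unfolding hsq_def by (intro continuous_intros)

lemma continuous_on_heis_B [continuous_intros]: "continuous_on S (heis_B \<iota>)"
  unfolding heis_B_eq_sum[abs_def] by (intro continuous_intros)

lemma continuous_on_heis_rho [continuous_intros]: "continuous_on S (heis_rho \<iota>)"
  unfolding heis_rho_def by (intro continuous_intros)

lemma hsq_add_ne_0: "0 < \<epsilon> \<Longrightarrow> hsq p + \<epsilon> \<noteq> 0"
  using hsq_nonneg[of p] by linarith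

lemma open_rho_greater: "open {p. c < heis_rho \<iota> p}"
  by (intro open_Collect_less continuous_intros)

lemma open_rho_less: "open {p. heis_rho \<iota> p < c}"
  by (intro open_Collect_less continuous_intros)

context
  fixes S :: "'n::finite heis set" and \<iota> :: 'n
  assumes rho_pos: "\<And>p. p \<in> S \<Longrightarrow> 0 < heis_rho \<iota> p"
begin

lemma continuous_on_rho_deriv: "continuous_on S (rho_deriv \<iota> k)"
  unfolding rho_deriv_def using rho_pos by (intro continuous_intros) fastforce

lemma log_norm_args_pos:
  assumes "p \<in> S"
  shows "0 < hsq p / 2 - heis_B \<iota> p + heis_rho \<iota> p" "0 < heis_B \<iota> p + heis_rho \<iota> p"
  using rho_pos[OF assms] two_heis_B_le_hsq[of \<iota> p] heis_B_nonneg[of \<iota> p] by linarith+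

lemma continuous_on_log_norm: "continuous_on S (log_norm \<iota>)"
  unfolding log_norm_def Let_def using rho_pos log_norm_args_pos
  by (intro continuous_intros; fastforce)

lemma continuous_on_log_norm_deriv: "continuous_on S (log_norm_deriv \<iota> k)"
  unfolding log_norm_deriv_def Let_def using rho_pos log_norm_args_pos
  by (intro continuous_intros continuous_on_rho_deriv; fastforce)

lemma continuous_on_heis_norm: "continuous_on S (heis_norm \<iota>)"
proof -
  have "continuous_on S (\<lambda>p. exp (log_norm \<iota> p))"
    by (intro continuous_intros continuous_on_log_norm)
  then show ?thesis
    by (rule continuous_on_eq) (simp add: heis_norm_eq_exp rho_pos)
qed

lemma continuous_on_hardy_coef: "0 < \<epsilon> \<Longrightarrow> continuous_on S (hardy_coef \<epsilon> \<iota> k)"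
  unfolding hardy_coef_def using rho_pos hsq_add_ne_0
  by (intro continuous_intros) fastforce+

lemma continuous_on_hardy_coef_deriv: "0 < \<epsilon> \<Longrightarrow> continuous_on S (hardy_coef_deriv \<epsilon> \<iota> k)"
  unfolding hardy_coef_deriv_def Let_def using rho_pos hsq_add_ne_0
  by (intro continuous_intros continuous_on_rho_deriv) fastforce+

end

text \<open>Bounded because \<open>|x|^2 <= 4 B <= 4 \<rho>\<close> and
  \<open>|t| <= \<rho>\<close>. These shells contain the supports of the cutoffs, so continuous
  coefficients are bounded there.\<close>

lemma compact_rho_between: "compact {p :: 'n::finite heis. a \<le> heis_rho \<iota> p \<and> heis_rho \<iota> p \<le> b}"
proof (rule compact_eq_bounded_closed[THEN iffD2], intro conjI)
  show "closed {p :: 'n heis. a \<le> heis_rho \<iota> p \<and> heis_rho \<iota> p \<le> b}"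
    by (intro closed_Collect_conj closed_Collect_le continuous_intros)
  have "norm p \<le> sqrt (4 * b + b\<^sup>2)" if "heis_rho \<iota> p \<le> b" for p :: "'n heis"
  proof -
    obtain x y t where p: "p = (x, y, t)" by (cases p)
    have "(norm z)\<^sup>2 = (\<Sum>j\<in>UNIV. (z $ j)\<^sup>2)" for z :: "real ^ 'n"
      by (simp add: norm_vec_def L2_set_def sum_nonneg)
    then have "hsq p = (norm x)\<^sup>2 + (norm y)\<^sup>2"
      by (simp add: p hsq_def sum_bool_pair hcoord_def sum.distrib)
    then have "norm p = sqrt (hsq p + t\<^sup>2)"
      by (simp add: p norm_Pair add.assoc)
    moreover have "hsq p \<le> 4 * b"
      using hsq_le_four_heis_B[of p \<iota>] heis_B_le_rho[of \<iota> p] that by linarith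
    moreover have "t\<^sup>2 \<le> b\<^sup>2"
      using abs_vert_le_rho[of p \<iota>] that by (auto simp: p vert_def intro!: power2_le_iff_abs_le[THEN iffD2])
    ultimately show ?thesis by simp
  qed
  then show "bounded {p :: 'n heis. a \<le> heis_rho \<iota> p \<and> heis_rho \<iota> p \<le> b}"
    by (auto intro!: boundedI)
qed

lemma has_hderiv_transform_open:
  assumes "has_hderiv \<iota> k u d p" "open S" "p \<in> S" "\<And>x. x \<in> S \<Longrightarrow> u x = u' x"
  shows "has_hderiv \<iota> k u' d p"
proof (rule has_field_derivative_transform_within_open[OF assms(1)])
  show "open ((\<lambda>s. p + s *\<^sub>R hfield \<iota> k p) -` S)"
    by (intro open_vimage assms continuous_intros)
qed (use assms in auto)

section \<open>The estimate with cutoffs\<close>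

definition hderiv :: "'n::finite \<Rightarrow> bool \<times> 'n \<Rightarrow> ('n heis \<Rightarrow> real) \<Rightarrow> 'n heis \<Rightarrow> real" where
  "hderiv \<iota> k f p = deriv (\<lambda>s. f (p + s *\<^sub>R hfield \<iota> k p)) 0"

lemma subgrad_norm_eq_hderiv: "subgrad_norm \<iota> f p = sqrt (\<Sum>k\<in>UNIV. (hderiv \<iota> k f p)\<^sup>2)"
  by (simp add: subgrad_norm_def sum_bool_pair hderiv_def hfield_def X_deriv_def Y_deriv_def)

lemma has_hderiv_hderiv:
  "horizontally_differentiable_at \<iota> f p \<Longrightarrow> has_hderiv \<iota> k f (hderiv \<iota> k f p) p"
  by (cases "fst k")
    (auto simp: horizontally_differentiable_at_def hderiv_def hfield_def DERIV_deriv_iff_real_differentiable)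

lemma abs_hderiv_le_subgrad_norm: "\<bar>hderiv \<iota> k f p\<bar> \<le> subgrad_norm \<iota> f p"
  unfolding subgrad_norm_eq_hderiv
  by (rule real_le_rsqrt) (simp add: member_le_sum[of k UNIV "\<lambda>k. (hderiv \<iota> k f p)\<^sup>2"])

lemma subgrad_norm_nonneg: "0 \<le> subgrad_norm \<iota> f p"
  by (simp add: subgrad_norm_eq_hderiv sum_nonneg)

lemma one_less_heis_norm:
  assumes "2 < heis_rho \<iota> p"
  shows "1 < heis_norm \<iota> p"
proof -
  have "1 < (heis_norm \<iota> p)\<^sup>2" "0 < heis_norm \<iota> p"
    using heis_norm_sq_bounds(1)[of \<iota> p] heis_norm_eq_exp[of \<iota> p] assms by auto
  then show ?thesis by (metis less_le_not_le one_le_power power2_less_imp_less power_one zero_le_one le_less_linear)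
qed

lemma has_hderiv_heis_norm:
  assumes "0 < heis_rho \<iota> p"
  shows "has_hderiv \<iota> k (heis_norm \<iota>) (heis_norm \<iota> p * log_norm_deriv \<iota> k p) p"
proof (rule has_hderiv_transform_open[where u = "\<lambda>p. exp (log_norm \<iota> p)" and S = "{p. 0 < heis_rho \<iota> p}"])
  show "has_hderiv \<iota> k (\<lambda>p. exp (log_norm \<iota> p)) (heis_norm \<iota> p * log_norm_deriv \<iota> k p) p"
    using DERIV_chain2[OF DERIV_exp has_hderiv_log_norm[OF assms]] assms by (simp add: heis_norm_eq_exp)
qed (use assms in \<open>auto simp: open_rho_greater heis_norm_eq_exp\<close>)

text \<open>Serves integrability only: the bound blows up as \<open>\<epsilon>\<close> tends to 0
  and does not enter the final constants.\<close>

lemma abs_hardy_coef_le: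
  fixes p :: "'n::finite heis"
  assumes "0 < heis_rho \<iota> p" "0 < \<epsilon>"
  shows "\<bar>hardy_coef \<epsilon> \<iota> k p\<bar> \<le> sqrt (288 / \<epsilon>)"
proof (rule real_le_rsqrt)
  have "(hardy_coef \<epsilon> \<iota> k p)\<^sup>2 \<le> (\<Sum>k\<in>UNIV. (hardy_coef \<epsilon> \<iota> k p)\<^sup>2)"
    by (simp add: member_le_sum[of k UNIV "\<lambda>k. (hardy_coef \<epsilon> \<iota> k p)\<^sup>2"])
  also have "\<dots> \<le> 288 / (hsq p + \<epsilon>)" by (rule sum_hardy_coef_sq[OF assms])
  also have "\<dots> \<le> 288 / \<epsilon>" using assms hsq_nonneg[of p] by (intro divide_left_mono) auto
  finally show "\<bar>hardy_coef \<epsilon> \<iota> k p\<bar>\<^sup>2 \<le> 288 / \<epsilon>" by simp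
qed

lemma bounded_on_compact:
  fixes u :: "'a::topological_space \<Rightarrow> real"
  assumes "compact K" "continuous_on K u"
  obtains M where "0 \<le> M" "\<And>p. p \<in> K \<Longrightarrow> \<bar>u p\<bar> \<le> M"
proof -
  have "bounded (u ` K)" by (intro compact_imp_bounded compact_continuous_image assms)
  then obtain M where "\<And>p. p \<in> K \<Longrightarrow> \<bar>u p\<bar> \<le> M" by (auto simp: bounded_iff)
  then have "\<And>p. p \<in> K \<Longrightarrow> \<bar>u p\<bar> \<le> max 0 M" by (simp add: le_max_iff_disj)
  then show ?thesis using that[of "max 0 M"] by simp
qed

text \<open>The region \<open>\<rho> > 2\<close> replaces \<open>N > 1\<close>. It is open, lies
  inside \<open>N > 1\<close> because \<open>N^2 >= \<rho> / 2\<close>, and suits cutoffs that are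
  functions of \<open>\<rho>\<close>.\<close>

locale weighted_heis =
  fixes \<iota> :: "'n::finite" and g g' :: "real \<Rightarrow> real" and q :: real and f :: "'n heis \<Rightarrow> real"
  assumes dim: "2 \<le> CARD('n)" and q: "2 \<le> q"
    and g_deriv: "\<And>r. 1 < r \<Longrightarrow> (g has_real_derivative g' r) (at r)"
    and g'_nonneg: "\<And>r. 1 < r \<Longrightarrow> 0 \<le> g' r"
    and g'_cont: "continuous_on {1<..} g'"
    and f_meas: "(\<lambda>p. indicator {p. 2 < heis_rho \<iota> p} p * f p) \<in> borel_measurable lebesgue"
    and f_diff: "\<And>p. 2 < heis_rho \<iota> p \<Longrightarrow> horizontally_differentiable_at \<iota> f p"
begin

abbreviation (input) \<Omega> :: "'n heis set" where "\<Omega> \<equiv> {p. 2 < heis_rho \<iota> p}"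

abbreviation (input) F :: "'n heis \<Rightarrow> real" where "F p \<equiv> \<bar>f p\<bar> powr q"

abbreviation (input) W :: "'n heis \<Rightarrow> real" where "W p \<equiv> exp (- g (heis_norm \<iota> p))"

lemma sets_\<Omega>: "\<Omega> \<in> sets lebesgue" "\<Omega> \<in> sets borel"
  using open_rho_greater[of 2 \<iota>] by auto

lemma borel_measurable_hderiv: "hderiv \<iota> k f \<in> borel_measurable (lebesgue_on \<Omega>)"
proof (rule measure_preserving_flow.borel_measurable_flow_derivative[OF measure_preserving_flow_hfield f_meas sets_\<Omega>(1)])
  fix p assume p: "p \<in> \<Omega>"
  show "has_hderiv \<iota> k (\<lambda>p. indicator \<Omega> p * f p) (hderiv \<iota> k f p) p"
    by (rule has_hderiv_transform_open[OF has_hderiv_hderiv[OF f_diff] open_rho_greater[of 2 \<iota>]])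
      (use p in auto)
qed

lemma borel_measurable_subgrad: "(\<lambda>p. indicator \<Omega> p * subgrad_norm \<iota> f p) \<in> borel_measurable lebesgue"
proof -
  have "subgrad_norm \<iota> f \<in> borel_measurable (lebesgue_on \<Omega>)"
    unfolding subgrad_norm_eq_hderiv[abs_def]
    by (intro borel_measurable_sqrt borel_measurable_sum borel_measurable_power borel_measurable_hderiv
      measurable_compose[OF _ borel_measurable_sqrt])
  then show ?thesis
    using sets_\<Omega>(1) by (subst (asm) borel_measurable_restrict_space_iff) auto
qed

lemma continuous_on_norm: "continuous_on \<Omega> (heis_norm \<iota>)"
  by (rule continuous_on_heis_norm) simp

lemma continuous_on_g_norm: "continuous_on \<Omega> (\<lambda>p. g (heis_norm \<iota> p))"
proof -
  have "continuous_on {1<..} g"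
    using g_deriv by (intro continuous_at_imp_continuous_on ballI DERIV_isCont) auto
  then show ?thesis
    by (rule continuous_on_compose2[OF _ continuous_on_norm]) (auto simp: one_less_heis_norm)
qed

lemma continuous_on_g'_norm: "continuous_on \<Omega> (\<lambda>p. g' (heis_norm \<iota> p))"
  by (rule continuous_on_compose2[OF g'_cont continuous_on_norm]) (auto simp: one_less_heis_norm)

text \<open>The right-hand side contains neither \<open>\<epsilon>\<close> nor \<open>R\<close>, so
  both can be removed by a limit. In the last coefficient, \<open>24 n + 24\<close> is the bounded
  part \<open>12 (2 n + 2)\<close> of the divergence, and \<open>96 = 4 * 24\<close> bounds the
  derivative of the cutoff along the field.\<close>

lemma cutoff_estimate:
  fixes \<psi> \<psi>' :: "real \<Rightarrow> real" and R \<epsilon> :: real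
  assumes \<psi>: "\<And>x. (\<psi> has_real_derivative \<psi>' x) (at x)" and \<psi>'_cont: "continuous_on UNIV \<psi>'"
    and \<psi>_bounds: "\<And>x. 0 \<le> \<psi> x" "\<And>x. \<psi> x \<le> 1" and \<psi>'_bound: "\<And>x. \<bar>\<psi>' x\<bar> \<le> 4"
    and supp: "\<And>x. x < 3 \<or> R < x \<Longrightarrow> \<psi> x = 0 \<and> \<psi>' x = 0"
    and \<epsilon>: "0 < \<epsilon>"
    and intF: "integrable lebesgue (\<lambda>p. indicator \<Omega> p * (W p * F p))"
    and intG: "integrable lebesgue (\<lambda>p. indicator \<Omega> p * (W p * subgrad_norm \<iota> f p powr q))"
  shows "(\<integral>\<^sup>+p. ennreal (indicator \<Omega> p * (\<psi> (heis_rho \<iota> p) * g' (heis_norm \<iota> p) * heis_norm \<iota> p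
        * (heis_B \<iota> p / heis_rho \<iota> p / (hsq p + \<epsilon>)) * (W p * F p))) \<partial>lebesgue)
    \<le> ennreal (72 * q\<^sup>2 * (LINT p|lebesgue. indicator \<Omega> p * (W p * subgrad_norm \<iota> f p powr q))
       + (72 * q\<^sup>2 + 24 * real CARD('n) + 120) * (LINT p|lebesgue. indicator \<Omega> p * (W p * F p)))"
proof -
  define v where "v = (\<lambda>k. hardy_coef \<epsilon> \<iota> k)"
  define v' where "v' = (\<lambda>k. hardy_coef_deriv \<epsilon> \<iota> k)"
  \<comment> \<open>Summed over \<open>k\<close>, this is the divergence of
    \<open>\<psi>(\<rho>) W V\<close> divided by the weight \<open>W\<close>.\<close>
  define u where "u = (\<lambda>k p. \<psi>' (heis_rho \<iota> p) * (v k p * rho_deriv \<iota> k p) + \<psi> (heis_rho \<iota> p) * v' k p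
    - \<psi> (heis_rho \<iota> p) * g' (heis_norm \<iota> p) * heis_norm \<iota> p * (v k p * log_norm_deriv \<iota> k p))"
  define h where "h = (\<lambda>k p. indicator \<Omega> p * (W p * (F p * (\<psi> (heis_rho \<iota> p) * v k p))))"
  define h' where "h' = (\<lambda>k p. indicator \<Omega> p * (W p *
    (q * \<bar>f p\<bar> powr (q - 1) * sgn (f p) * \<psi> (heis_rho \<iota> p) * (v k p * hderiv \<iota> k f p) + F p * u k p)))"
  have rho_pos: "0 < heis_rho \<iota> p" if "p \<in> \<Omega>" for p using that by simp
  have vb: "\<bar>v k p\<bar> \<le> sqrt (288 / \<epsilon>)" if "p \<in> \<Omega>" for k p
    unfolding v_def by (rule abs_hardy_coef_le[OF rho_pos[OF that] \<epsilon>])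
  have \<psi>_cont: "continuous_on S \<psi>" for S
    using \<psi> by (intro continuous_at_imp_continuous_on ballI DERIV_isCont) auto
  have N1: "1 < heis_norm \<iota> p" if "p \<in> \<Omega>" for p
    by (rule one_less_heis_norm) (use that in simp)
  have c\<psi>: "continuous_on S (\<lambda>p. \<psi> (heis_rho \<iota> p))" for S
    by (rule continuous_on_compose2[OF \<psi>_cont continuous_on_heis_rho]) auto
  have c\<psi>': "continuous_on S (\<lambda>p. \<psi>' (heis_rho \<iota> p))" for S
    by (rule continuous_on_compose2[OF \<psi>'_cont continuous_on_heis_rho]) auto
  have cv: "continuous_on \<Omega> (v k)" for k
    unfolding v_def by (rule continuous_on_hardy_coef[OF rho_pos \<epsilon>])
  \<comment> \<open>The open sets \<open>\<rho> > 2\<close> and \<open>\<rho> < 3\<close> cover the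
    space, and \<open>h k\<close> vanishes on the second. Thus the extension by zero is
    differentiable everywhere.\<close>
  have D: "has_hderiv \<iota> k (h k) (h' k p) p" for k p
  proof (cases "p \<in> \<Omega>")
    case True
    have "has_hderiv \<iota> k (\<lambda>p. g (heis_norm \<iota> p)) (g' (heis_norm \<iota> p) * (heis_norm \<iota> p * log_norm_deriv \<iota> k p)) p"
      using DERIV_chain2[OF _ has_hderiv_heis_norm[OF rho_pos[OF True]]] g_deriv[OF N1[OF True]] by simp
    then have DW: "has_hderiv \<iota> k W (W p * - (g' (heis_norm \<iota> p) * (heis_norm \<iota> p * log_norm_deriv \<iota> k p))) p"
      using DERIV_chain2[OF DERIV_exp DERIV_minus] by force
    have DF: "has_hderiv \<iota> k F (q * \<bar>f p\<bar> powr (q - 1) * sgn (f p) * hderiv \<iota> k f p) p"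
      using DERIV_chain2[OF DERIV_abs_powr has_hderiv_hderiv[OF f_diff[of p], of k], of q] q True by simp
    have D\<psi>: "has_hderiv \<iota> k (\<lambda>p. \<psi> (heis_rho \<iota> p)) (\<psi>' (heis_rho \<iota> p) * rho_deriv \<iota> k p) p"
      using DERIV_chain2[OF \<psi> has_hderiv_heis_rho[OF rho_pos[OF True]]] by simp
    have Dv: "has_hderiv \<iota> k (v k) (v' k p) p"
      unfolding v_def v'_def by (rule has_hderiv_hardy_coef[OF rho_pos[OF True] \<epsilon>])
    have "has_hderiv \<iota> k (\<lambda>p. W p * (F p * (\<psi> (heis_rho \<iota> p) * v k p))) (h' k p) p"
      by (rule DERIV_cong[OF DERIV_mult[OF DW DERIV_mult[OF DF DERIV_mult[OF D\<psi> Dv]]]])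
        (use True in \<open>simp add: h'_def u_def algebra_simps\<close>)
    then show ?thesis
      by (rule has_hderiv_transform_open[OF _ open_rho_greater[of 2 \<iota>]]) (use True in \<open>auto simp: h_def\<close>)
  next
    case False
    then have p: "p \<in> {p. heis_rho \<iota> p < 3}" by simp
    have "h' k p = 0" using False by (simp add: h'_def)
    then have "has_hderiv \<iota> k (\<lambda>_. 0) (h' k p) p" by simp
    then show ?thesis
      by (rule has_hderiv_transform_open[OF _ open_rho_less[of \<iota> 3] p]) (simp add: h_def supp)
  qed
  have hm: "h k \<in> borel_measurable lebesgue" for k
  proof -
    have "(\<lambda>p. if p \<in> \<Omega> then W p * (\<psi> (heis_rho \<iota> p) * v k p) else 0) \<in> borel_measurable borel"
      by (intro borel_measurable_continuous_on_if continuous_intros continuous_on_g_norm c\<psi> cv sets_\<Omega>(2))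
    then have "(\<lambda>p. if p \<in> \<Omega> then W p * (\<psi> (heis_rho \<iota> p) * v k p) else 0) \<in> borel_measurable lebesgue"
      by (simp add: measurable_completion)
    then have "(\<lambda>p. \<bar>indicator \<Omega> p * f p\<bar> powr q * (if p \<in> \<Omega> then W p * (\<psi> (heis_rho \<iota> p) * v k p) else 0)) \<in> borel_measurable lebesgue"
      by (intro borel_measurable_times powr_real_measurable borel_measurable_abs f_meas borel_measurable_const)
    also have "(\<lambda>p. \<bar>indicator \<Omega> p * f p\<bar> powr q * (if p \<in> \<Omega> then W p * (\<psi> (heis_rho \<iota> p) * v k p) else 0)) = h k"
      by (auto simp: h_def fun_eq_iff)
    finally show ?thesis .
  qed
  have h_int: "integrable lebesgue (h k)" for k
  proof (rule Bochner_Integration.integrable_bound[OF integrable_mult_right[OF intF, of "sqrt (288 / \<epsilon>)"] hm])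
    show "AE p in lebesgue. norm (h k p) \<le> norm (sqrt (288 / \<epsilon>) * (indicator \<Omega> p * (W p * F p)))"
    proof (rule AE_I2)
      fix p :: "'n heis"
      show "norm (h k p) \<le> norm (sqrt (288 / \<epsilon>) * (indicator \<Omega> p * (W p * F p)))"
      proof (cases "p \<in> \<Omega>")
        case True
        have "\<psi> (heis_rho \<iota> p) * \<bar>v k p\<bar> \<le> 1 * sqrt (288 / \<epsilon>)"
          using \<psi>_bounds vb[OF True] by (intro mult_mono) auto
        then have "(W p * F p) * (\<psi> (heis_rho \<iota> p) * \<bar>v k p\<bar>) \<le> (W p * F p) * sqrt (288 / \<epsilon>)"
          by (intro mult_left_mono) auto
        then show ?thesis using True \<psi>_bounds(1)[of "heis_rho \<iota> p"] \<epsilon>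
          by (simp add: h_def abs_mult mult_ac)
      qed (simp add: h_def)
    qed
  qed
  have h'm: "h' k \<in> borel_measurable lebesgue" for k
    using measure_preserving_flow.borel_measurable_flow_derivative[OF measure_preserving_flow_hfield hm[of k], of UNIV \<iota> k "h' k"] D
    by simp
  \<comment> \<open>Here the outer cutoff is essential: no growth bound on \<open>g'\<close> at
    infinity is available, so \<open>u k\<close> is bounded only through its compact support. The
    bound \<open>M\<close> serves integrability alone.\<close>
  have h'_int: "integrable lebesgue (h' k)" for k
  proof -
    let ?K = "{p. 3 \<le> heis_rho \<iota> p \<and> heis_rho \<iota> p \<le> R}"
    have KO: "?K \<subseteq> \<Omega>" by auto
    have "continuous_on \<Omega> (u k)"
      unfolding u_def v'_def
      by (intro continuous_intros c\<psi> c\<psi>' cv continuous_on_g'_norm continuous_on_norm continuous_on_rho_deriv continuous_on_log_norm_deriv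
          continuous_on_hardy_coef_deriv \<epsilon>) auto
    then have "continuous_on ?K (u k)" by (rule continuous_on_subset[OF _ KO])
    from bounded_on_compact[OF compact_rho_between this]
    obtain M where M: "0 \<le> M" "\<And>p. p \<in> ?K \<Longrightarrow> \<bar>u k p\<bar> \<le> M" by auto
    have ub: "\<bar>u k p\<bar> \<le> M" if "p \<in> \<Omega>" for p
    proof (cases "p \<in> ?K")
      case False
      then have "heis_rho \<iota> p < 3 \<or> R < heis_rho \<iota> p" by auto
      from supp[OF this] show ?thesis using M by (simp add: u_def)
    qed (use M in auto)
    define s where "s = sqrt (288 / \<epsilon>)"
    have s: "0 \<le> s" using \<epsilon> by (simp add: s_def)
    show ?thesis
    proof (rule Bochner_Integration.integrable_bound[OF Bochner_Integration.integrable_add[OF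
            integrable_mult_right[OF intF, of "q * s + M"] integrable_mult_right[OF intG, of "q * s"]] h'm])
      show "AE p in lebesgue. norm (h' k p) \<le> norm ((q * s + M) * (indicator \<Omega> p * (W p * F p))
          + q * s * (indicator \<Omega> p * (W p * subgrad_norm \<iota> f p powr q)))"
      proof (rule AE_I2)
        fix p :: "'n heis"
        show "norm (h' k p) \<le> norm ((q * s + M) * (indicator \<Omega> p * (W p * F p))
          + q * s * (indicator \<Omega> p * (W p * subgrad_norm \<iota> f p powr q)))"
        proof (cases "p \<in> \<Omega>")
          case True
          let ?G = "subgrad_norm \<iota> f p powr q"
          have "\<bar>f p\<bar> powr (q - 1) * \<bar>hderiv \<iota> k f p\<bar> \<le> \<bar>f p\<bar> powr (q - 1) * subgrad_norm \<iota> f p powr 1"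
            using abs_hderiv_le_subgrad_norm[of \<iota> k f p] by (intro mult_left_mono) (auto simp: subgrad_norm_nonneg)
          also have "\<dots> \<le> F p + ?G"
            using q by (intro powr_mult_le_add_powr) (auto simp: subgrad_norm_nonneg)
          finally have 1: "\<bar>f p\<bar> powr (q - 1) * \<bar>hderiv \<iota> k f p\<bar> \<le> F p + ?G" .
          have "\<bar>sgn (f p)\<bar> * \<psi> (heis_rho \<iota> p) * \<bar>v k p\<bar> \<le> 1 * 1 * s"
            using \<psi>_bounds vb[OF True] s unfolding s_def by (intro mult_mono) (auto simp: sgn_if)
          then have "q * (\<bar>f p\<bar> powr (q - 1) * \<bar>hderiv \<iota> k f p\<bar>) * (\<bar>sgn (f p)\<bar> * \<psi> (heis_rho \<iota> p) * \<bar>v k p\<bar>) \<le> q * (F p + ?G) * s"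
            using 1 q s \<psi>_bounds(1) by (intro mult_mono mult_left_mono) auto
          moreover have "F p * \<bar>u k p\<bar> \<le> F p * M" using ub[OF True] by (intro mult_left_mono) auto
          moreover have "\<bar>q * \<bar>f p\<bar> powr (q - 1) * sgn (f p) * \<psi> (heis_rho \<iota> p) * (v k p * hderiv \<iota> k f p) + F p * u k p\<bar>
             \<le> q * (\<bar>f p\<bar> powr (q - 1) * \<bar>hderiv \<iota> k f p\<bar>) * (\<bar>sgn (f p)\<bar> * \<psi> (heis_rho \<iota> p) * \<bar>v k p\<bar>) + F p * \<bar>u k p\<bar>"
            using q \<psi>_bounds(1)[of "heis_rho \<iota> p"]
            by (intro order_trans[OF abs_triangle_ineq]) (simp add: abs_mult mult_ac)
          ultimately have "\<bar>q * \<bar>f p\<bar> powr (q - 1) * sgn (f p) * \<psi> (heis_rho \<iota> p) * (v k p * hderiv \<iota> k f p) + F p * u k p\<bar>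
             \<le> (q * s + M) * F p + q * s * ?G" by (simp add: algebra_simps)
          then have "W p * \<bar>q * \<bar>f p\<bar> powr (q - 1) * sgn (f p) * \<psi> (heis_rho \<iota> p) * (v k p * hderiv \<iota> k f p) + F p * u k p\<bar>
             \<le> W p * ((q * s + M) * F p + q * s * ?G)" by (intro mult_left_mono) auto
          also have "\<dots> = (q * s + M) * (W p * F p) + q * s * (W p * ?G)" by (simp add: algebra_simps)
          finally have "norm (h' k p) \<le> (q * s + M) * (W p * F p) + q * s * (W p * ?G)"
            using True by (simp add: h'_def abs_mult)
          then show ?thesis using True by simp
        qed (simp add: h'_def)
      qed
    qed
  qed
  have "(LINT p|lebesgue. (\<Sum>k\<in>UNIV. h' k p)) = (\<Sum>k\<in>UNIV. integral\<^sup>L lebesgue (h' k))"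
    by (rule Bochner_Integration.integral_sum) (rule h'_int)
  also have "\<dots> = 0"
    using measure_preserving_flow.integral_flow_derivative_eq_0[OF measure_preserving_flow_hfield h_int h'_int D] by simp
  finally have int0: "(LINT p|lebesgue. (\<Sum>k\<in>UNIV. h' k p)) = 0" .
  have S_int: "integrable lebesgue (\<lambda>p. \<Sum>k\<in>UNIV. h' k p)"
    by (rule Bochner_Integration.integrable_sum) (rule h'_int)
  let ?C = "72 * q\<^sup>2" and ?D = "72 * q\<^sup>2 + 24 * real CARD('n) + 120"
  \<comment> \<open>\<open>T\<close> is the claimed right-hand integrand minus a function of
    integral zero, so the estimate reduces to the pointwise inequality
    \<open>L p \<le> T p\<close>.\<close>
  define T where "T = (\<lambda>p. ?C * (indicator \<Omega> p * (W p * subgrad_norm \<iota> f p powr q))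
      + ?D * (indicator \<Omega> p * (W p * F p)) - (\<Sum>k\<in>UNIV. h' k p))"
  define L where "L = (\<lambda>p. indicator \<Omega> p * (\<psi> (heis_rho \<iota> p) * g' (heis_norm \<iota> p) * heis_norm \<iota> p
        * (heis_B \<iota> p / heis_rho \<iota> p / (hsq p + \<epsilon>)) * (W p * F p)))"
  have T_int: "integrable lebesgue T"
    unfolding T_def by (intro Bochner_Integration.integrable_diff Bochner_Integration.integrable_add integrable_mult_right intF intG S_int)
  have T_eq: "integral\<^sup>L lebesgue T = ?C * (LINT p|lebesgue. indicator \<Omega> p * (W p * subgrad_norm \<iota> f p powr q))
       + ?D * (LINT p|lebesgue. indicator \<Omega> p * (W p * F p))"
    unfolding T_def using int0 intF intG S_int
    by (simp add: Bochner_Integration.integral_diff Bochner_Integration.integral_add Bochner_Integration.integrable_add integrable_mult_right)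
  have LT: "0 \<le> L p \<and> L p \<le> T p" for p
  proof (cases "p \<in> \<Omega>")
    case True
    define \<Lambda> where "\<Lambda> = 1 / (hsq p + \<epsilon>)"
    define a s V X where "a = \<bar>f p\<bar>" and "s = subgrad_norm \<iota> f p" and "V = sqrt (\<Sum>k\<in>UNIV. (v k p)\<^sup>2)"
      and "X = (\<Sum>k\<in>UNIV. v k p * hderiv \<iota> k f p)"
    define y where "y = \<psi> (heis_rho \<iota> p)"
    define G where "G = g' (heis_norm \<iota> p) * heis_norm \<iota> p"
    define n where "n = real CARD('n)"
    have n: "2 \<le> n" using dim by (simp add: n_def)
    have y: "0 \<le> y" "y \<le> 1" using \<psi>_bounds by (auto simp: y_def)
    have \<Lambda>: "0 < \<Lambda>" using \<epsilon> hsq_nonneg[of p] by (simp add: \<Lambda>_def)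
    have G: "0 \<le> G" using N1[OF True] g'_nonneg by (simp add: G_def)
    have b: "0 \<le> heis_B \<iota> p / heis_rho \<iota> p * \<Lambda>" using \<Lambda> heis_B_nonneg[of \<iota> p] heis_rho_nonneg[of \<iota> p] by simp
    have V2: "V\<^sup>2 \<le> 288 * \<Lambda>" "0 \<le> V"
      using sum_hardy_coef_sq[OF rho_pos[OF True] \<epsilon>] by (simp_all add: V_def v_def \<Lambda>_def sum_nonneg)
    have X: "\<bar>X\<bar> \<le> s * V"
    proof (rule power2_le_imp_le)
      have "X\<^sup>2 \<le> (\<Sum>k\<in>UNIV. (v k p)\<^sup>2) * (\<Sum>k\<in>UNIV. (hderiv \<iota> k f p)\<^sup>2)"
        unfolding X_def by (rule Cauchy_Schwarz_ineq_sum)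
      also have "\<dots> = (s * V)\<^sup>2"
        by (simp add: V_def s_def subgrad_norm_eq_hderiv power_mult_distrib sum_nonneg)
      finally show "\<bar>X\<bar>\<^sup>2 \<le> (s * V)\<^sup>2" by simp
      show "0 \<le> s * V" using V2 by (simp add: s_def subgrad_norm_nonneg)
    qed
    have S_eq: "(\<Sum>k\<in>UNIV. h' k p) = W p * (q * a powr (q - 1) * sgn (f p) * y * X + F p * (\<Sum>k\<in>UNIV. u k p))"
      using True by (simp add: h'_def sum.distrib sum_distrib_left[symmetric] a_def y_def X_def)
    have u_eq: "(\<Sum>k\<in>UNIV. u k p) = \<psi>' (heis_rho \<iota> p) * (\<Sum>k\<in>UNIV. v k p * rho_deriv \<iota> k p)
        + y * (\<Sum>k\<in>UNIV. v' k p) - y * G * (\<Sum>k\<in>UNIV. v k p * log_norm_deriv \<iota> k p)"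
      by (simp add: u_def sum.distrib sum_subtractf sum_distrib_left[symmetric] y_def G_def mult.assoc)
    have "\<psi>' (heis_rho \<iota> p) * (\<Sum>k\<in>UNIV. v k p * rho_deriv \<iota> k p) \<le> 96"
    proof -
      have "\<bar>\<psi>' (heis_rho \<iota> p) * (\<Sum>k\<in>UNIV. v k p * rho_deriv \<iota> k p)\<bar> \<le> 4 * 24"
        unfolding abs_mult v_def using abs_hardy_field_rho[OF rho_pos[OF True] \<epsilon>] \<psi>'_bound
        by (intro mult_mono) auto
      then show ?thesis by linarith
    qed
    moreover have "y * (\<Sum>k\<in>UNIV. v' k p) \<le> y * ((2 - 2 * n) * \<Lambda>) + 12 * (2 * n + 2)"
    proof -
      have "y * (\<Sum>k\<in>UNIV. v' k p) \<le> y * ((2 - 2 * n) * \<Lambda> + 12 * (2 * n + 2))"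
        using hardy_field_divergence[of \<iota> p, OF _ \<epsilon>] True y unfolding v'_def \<Lambda>_def n_def
        by (intro mult_left_mono) auto
      moreover have "y * (12 * (2 * n + 2)) \<le> 1 * (12 * (2 * n + 2))" using y n by (intro mult_right_mono) auto
      ultimately show ?thesis by (simp add: distrib_left)
    qed
    moreover have "y * G * (heis_B \<iota> p / heis_rho \<iota> p * \<Lambda>) \<le> y * G * (\<Sum>k\<in>UNIV. v k p * log_norm_deriv \<iota> k p)"
      using hardy_field_log_norm[OF rho_pos[OF True] \<epsilon>] y G unfolding v_def \<Lambda>_def
      by (intro mult_left_mono) auto
    ultimately have "(\<Sum>k\<in>UNIV. u k p) \<le> 96 + (y * ((2 - 2 * n) * \<Lambda>) + 12 * (2 * n + 2))
        - y * G * (heis_B \<iota> p / heis_rho \<iota> p * \<Lambda>)"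
      unfolding u_eq by linarith
    then have 1: "F p * (\<Sum>k\<in>UNIV. u k p) \<le> F p * (96 + (y * ((2 - 2 * n) * \<Lambda>) + 12 * (2 * n + 2))
        - y * G * (heis_B \<iota> p / heis_rho \<iota> p * \<Lambda>))"
      by (intro mult_left_mono) auto
    have 2: "q * a powr (q - 1) * sgn (f p) * y * X \<le> y * \<Lambda> * F p + ?C * (F p + s powr q)"
    proof -
      have "sgn (f p) * X \<le> s * V" using X V2 by (auto simp: sgn_if s_def subgrad_norm_nonneg)
      then have "(q * a powr (q - 1) * y) * (sgn (f p) * X) \<le> (q * a powr (q - 1) * y) * (s * V)"
        using q y by (intro mult_left_mono) auto
      also have "\<dots> = y * (q * a powr (q - 1) * s * V)" by (simp add: mult_ac)
      also have "\<dots> \<le> y * (V\<^sup>2 / 288 * a powr q + 72 * q\<^sup>2 * (a powr q + s powr q))"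
        using q y V2 by (intro mult_left_mono young_type_bound) (auto simp: a_def s_def subgrad_norm_nonneg)
      also have "\<dots> \<le> y * (\<Lambda> * a powr q) + 1 * (72 * q\<^sup>2 * (a powr q + s powr q))"
        unfolding distrib_left using y V2
        by (intro add_mono mult_left_mono mult_right_mono) (auto simp: a_def)
      finally show ?thesis by (simp add: a_def mult_ac)
    qed
    \<comment> \<open>The absorption at the axis: Young's inequality costs one unit of
      \<open>\<Lambda> |f|^q\<close>, the divergence pays \<open>2 n - 2\<close> units, and
      \<open>3 - 2 n\<close> is negative for \<open>n >= 2\<close>.\<close>
    have 3: "y * \<Lambda> * F p + F p * (y * ((2 - 2 * n) * \<Lambda>)) \<le> 0"
    proof -
      have "y * \<Lambda> * F p + F p * (y * ((2 - 2 * n) * \<Lambda>)) = (y * \<Lambda> * F p) * (3 - 2 * n)"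
        by (simp add: algebra_simps)
      also have "\<dots> \<le> 0" using y \<Lambda> n by (intro mult_nonneg_nonpos) auto
      finally show ?thesis .
    qed
    have "q * a powr (q - 1) * sgn (f p) * y * X + F p * (\<Sum>k\<in>UNIV. u k p)
      \<le> ?C * s powr q + ?D * F p - y * G * (heis_B \<iota> p / heis_rho \<iota> p * \<Lambda>) * F p"
      using 1 2 3 by (simp add: algebra_simps n_def)
    then have "W p * (q * a powr (q - 1) * sgn (f p) * y * X + F p * (\<Sum>k\<in>UNIV. u k p))
      \<le> W p * (?C * s powr q + ?D * F p - y * G * (heis_B \<iota> p / heis_rho \<iota> p * \<Lambda>) * F p)"
      by (intro mult_left_mono) auto
    also have "\<dots> = ?C * (W p * s powr q) + ?D * (W p * F p) - y * G * (heis_B \<iota> p / heis_rho \<iota> p * \<Lambda>) * (W p * F p)"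
      by (simp add: algebra_simps)
    finally have "y * G * (heis_B \<iota> p / heis_rho \<iota> p * \<Lambda>) * (W p * F p) \<le> T p"
      unfolding S_eq[symmetric] T_def using True by (simp add: s_def)
    moreover have "L p = y * G * (heis_B \<iota> p / heis_rho \<iota> p * \<Lambda>) * (W p * F p)"
      using True by (simp add: L_def y_def G_def \<Lambda>_def)
    moreover have "0 \<le> y * G * (heis_B \<iota> p / heis_rho \<iota> p * \<Lambda>) * (W p * F p)"
      by (intro mult_nonneg_nonneg[OF mult_nonneg_nonneg[OF mult_nonneg_nonneg b]]) (use y G in auto)
    ultimately show ?thesis by simp
  qed (simp add: L_def T_def h'_def)
  have "(\<integral>\<^sup>+p. ennreal (L p) \<partial>lebesgue) \<le> (\<integral>\<^sup>+p. ennreal (T p) \<partial>lebesgue)"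
    using LT by (intro nn_integral_mono ennreal_leI) auto
  also have "\<dots> = ennreal (integral\<^sup>L lebesgue T)"
  proof (rule nn_integral_eq_integral[OF T_int])
    have "0 \<le> T p" for p using LT[of p] by linarith
    then show "AE p in lebesgue. 0 \<le> T p" by simp
  qed
  finally show ?thesis unfolding T_eq L_def .
qed

end

section \<open>Removing the cutoffs\<close>

lemma has_real_derivative_pos_part_sq:
  "((\<lambda>x::real. (max 0 x)\<^sup>2) has_real_derivative 2 * max 0 x) (at x)"
proof (cases x "0::real" rule: linorder_cases)
  case less
  have "((\<lambda>x::real. 0) has_real_derivative 2 * max 0 x) (at x)" using less by simp
  then show ?thesis
    by (rule has_field_derivative_transform_within_open[where S = "{..<0}"]) (use less in auto)
next
  case greater
  have "((\<lambda>x::real. x\<^sup>2) has_real_derivative 2 * max 0 x) (at x)"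
    using greater by (auto intro!: derivative_eq_intros)
  then show ?thesis
    by (rule has_field_derivative_transform_within_open[where S = "{0<..}"]) (use greater in auto)
next
  case equal
  have lim: "((\<lambda>h. \<bar>h\<bar>) \<longlongrightarrow> 0) (at (0::real))"
    using tendsto_rabs_zero[OF tendsto_ident_at] by simp
  have "((\<lambda>h::real. (max 0 h)\<^sup>2 / h) \<longlongrightarrow> 0) (at 0)"
    by (rule Lim_null_comparison[OF _ lim])
      (auto simp: eventually_at_filter power2_eq_square max_def)
  then show ?thesis using equal by (simp add: has_field_derivative_iff)
qed

text \<open>A rational step of class C^1, since the squared positive part is C^1. It vanishes up to
  3 and has reached 1/2 at 4, which is the only lower bound required of it.\<close>

definition cutoff_in :: "real \<Rightarrow> real" where
  "cutoff_in x = (max 0 (x - 3))\<^sup>2 / (1 + (max 0 (x - 3))\<^sup>2)"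

text \<open>Vanishes beyond \<open>1 / \<delta>\<close> and tends to 1 as \<open>\<delta>\<close>
  tends to 0. For \<open>\<delta> > 0\<close> it exceeds 1 at negative arguments, but there
  \<open>cutoff_in\<close> is zero.\<close>

definition cutoff_out :: "real \<Rightarrow> real \<Rightarrow> real" where
  "cutoff_out \<delta> x = (max 0 (1 - \<delta> * x))\<^sup>2"

definition cutoff_deriv :: "real \<Rightarrow> real \<Rightarrow> real" where
  "cutoff_deriv \<delta> x = 2 * max 0 (x - 3) / (1 + (max 0 (x - 3))\<^sup>2)\<^sup>2 * cutoff_out \<delta> x
     + cutoff_in x * (- 2 * \<delta> * max 0 (1 - \<delta> * x))"

lemma one_plus_sq_pos: "0 < 1 + (y::real)\<^sup>2" "1 + (y::real)\<^sup>2 \<noteq> 0"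
  by (simp_all add: add_pos_nonneg) (smt (verit) zero_le_power2)

lemma has_real_derivative_cutoff:
  "((\<lambda>x. cutoff_in x * cutoff_out \<delta> x) has_real_derivative cutoff_deriv \<delta> x) (at x)"
proof -
  have P: "((\<lambda>x. (max 0 (x - 3))\<^sup>2) has_real_derivative 2 * max 0 (x - 3)) (at x)"
  proof -
    have "((\<lambda>x. x - 3) has_real_derivative 1) (at x)" by (auto intro!: derivative_eq_intros)
    from DERIV_chain2[OF has_real_derivative_pos_part_sq this] show ?thesis by simp
  qed
  have I: "(cutoff_in has_real_derivative 2 * max 0 (x - 3) / (1 + (max 0 (x - 3))\<^sup>2)\<^sup>2) (at x)"
  proof (rule DERIV_cong)
    show "(cutoff_in has_real_derivative (2 * max 0 (x - 3) * (1 + (max 0 (x - 3))\<^sup>2)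
        - (max 0 (x - 3))\<^sup>2 * (0 + 2 * max 0 (x - 3))) / ((1 + (max 0 (x - 3))\<^sup>2) * (1 + (max 0 (x - 3))\<^sup>2))) (at x)"
      unfolding cutoff_in_def[abs_def]
      by (rule DERIV_divide[OF P DERIV_add[OF DERIV_const P]]) (rule one_plus_sq_pos)
    show "(2 * max 0 (x - 3) * (1 + (max 0 (x - 3))\<^sup>2)
        - (max 0 (x - 3))\<^sup>2 * (0 + 2 * max 0 (x - 3))) / ((1 + (max 0 (x - 3))\<^sup>2) * (1 + (max 0 (x - 3))\<^sup>2))
      = 2 * max 0 (x - 3) / (1 + (max 0 (x - 3))\<^sup>2)\<^sup>2"
      by (simp add: power2_eq_square[of "1 + _"] algebra_simps)
  qed
  have O: "(cutoff_out \<delta> has_real_derivative - 2 * \<delta> * max 0 (1 - \<delta> * x)) (at x)"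
  proof -
    have "((\<lambda>x. 1 - \<delta> * x) has_real_derivative - \<delta>) (at x)" by (auto intro!: derivative_eq_intros)
    from DERIV_chain2[OF has_real_derivative_pos_part_sq this] show ?thesis
      by (simp add: cutoff_out_def[abs_def] mult_ac)
  qed
  show ?thesis
    by (rule DERIV_cong[OF DERIV_mult[OF I O]]) (simp add: cutoff_deriv_def)
qed

lemma continuous_cutoff_deriv: "continuous_on UNIV (cutoff_deriv \<delta>)"
  unfolding cutoff_deriv_def cutoff_in_def cutoff_out_def
  by (intro continuous_intros) (auto simp: one_plus_sq_pos)

lemma cutoff_in_bounds: "0 \<le> cutoff_in x" "cutoff_in x \<le> 1"
  using one_plus_sq_pos(1)[of "max 0 (x - 3)"] by (auto simp: cutoff_in_def)

lemma cutoff_in_eq_0: "x \<le> 3 \<Longrightarrow> cutoff_in x = 0"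
  by (simp add: cutoff_in_def)

lemma cutoff_out_bounds:
  assumes "0 \<le> \<delta>" "0 \<le> x"
  shows "0 \<le> cutoff_out \<delta> x" "cutoff_out \<delta> x \<le> 1"
proof -
  have "max 0 (1 - \<delta> * x) \<le> 1" using assms by simp
  then show "cutoff_out \<delta> x \<le> 1" unfolding cutoff_out_def by (intro power_le_one) auto
qed (simp add: cutoff_out_def)

lemma cutoff_bounds:
  assumes "0 \<le> \<delta>"
  shows "0 \<le> cutoff_in x * cutoff_out \<delta> x" "cutoff_in x * cutoff_out \<delta> x \<le> 1"
proof -
  have "0 \<le> cutoff_in x * cutoff_out \<delta> x \<and> cutoff_in x * cutoff_out \<delta> x \<le> 1"
  proof (cases "x \<le> 3")
    case False
    then show ?thesis using cutoff_in_bounds[of x] cutoff_out_bounds[OF assms, of x]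
      by (auto intro: mult_le_one)
  qed (simp add: cutoff_in_eq_0)
  then show "0 \<le> cutoff_in x * cutoff_out \<delta> x" "cutoff_in x * cutoff_out \<delta> x \<le> 1" by auto
qed

text \<open>The inner factor contributes at most 1 and the outer one at most 2, uniformly in
  \<open>\<delta>\<close>, so the cutoff error survives the limit.\<close>

lemma abs_cutoff_deriv_le:
  assumes "0 \<le> \<delta>" "\<delta> \<le> 1"
  shows "\<bar>cutoff_deriv \<delta> x\<bar> \<le> 4"
proof (cases "x \<le> 3")
  case False
  define s where "s = max 0 (x - 3)"
  have s: "0 \<le> s" by (simp add: s_def)
  have "2 * s \<le> 1 + s\<^sup>2" using sum_squares_bound[of s 1] by (simp add: power2_eq_square)
  also have "\<dots> \<le> (1 + s\<^sup>2)\<^sup>2" using self_le_power[of "1 + s\<^sup>2" 2] by simp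
  finally have "2 * s / (1 + s\<^sup>2)\<^sup>2 \<le> 1" by (simp add: one_plus_sq_pos)
  then have 1: "\<bar>2 * s / (1 + s\<^sup>2)\<^sup>2 * cutoff_out \<delta> x\<bar> \<le> 1 * 1"
    unfolding abs_mult using cutoff_out_bounds[of \<delta> x] assms False s by (intro mult_mono) auto
  have "\<delta> * max 0 (1 - \<delta> * x) \<le> 1 * 1" using assms False by (intro mult_mono) auto
  then have "\<bar>- 2 * \<delta> * max 0 (1 - \<delta> * x)\<bar> \<le> 2" using assms by (simp add: abs_mult)
  then have 2: "\<bar>cutoff_in x * (- 2 * \<delta> * max 0 (1 - \<delta> * x))\<bar> \<le> 1 * 2"
    unfolding abs_mult[of "cutoff_in x"] using cutoff_in_bounds[of x] by (intro mult_mono) auto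
  show ?thesis using 1 2 unfolding cutoff_deriv_def s_def by linarith
qed (simp add: cutoff_deriv_def cutoff_in_eq_0)

lemma cutoff_support:
  assumes "0 < \<delta>" "x < 3 \<or> 1 / \<delta> < x"
  shows "cutoff_in x * cutoff_out \<delta> x = 0 \<and> cutoff_deriv \<delta> x = 0"
proof (cases "x < 3")
  case False
  then have "max 0 (1 - \<delta> * x) = 0" using assms by (simp add: field_simps)
  then show ?thesis by (simp add: cutoff_deriv_def cutoff_out_def)
qed (simp add: cutoff_deriv_def cutoff_in_eq_0)

text \<open>The vertical axis lies in a coordinate hyperplane. On it the quotient
  \<open>B / |x|^2\<close> is \<open>0 / 0 = 0\<close>, so the lower bound \<open>1 / 4\<close>
  fails there.\<close>

lemma AE_hsq_nonzero: "AE p in lebesgue. hsq (p :: 'n::finite heis) \<noteq> 0"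
proof -
  fix j :: 'n
  let ?b = "(axis j 1, 0) :: 'n heis"
  have "?b \<in> Basis" by (auto simp: Basis_prod_def Basis_vec_def)
  then have "negligible {p. p \<bullet> ?b = 0}" by (rule negligible_standard_hyperplane)
  then have "AE p in lebesgue. p \<notin> {p. p \<bullet> ?b = 0}"
    by (intro AE_not_in) (simp add: negligible_iff_null_sets)
  then show ?thesis
  proof eventually_elim
    case (elim p)
    have "hcoord (True, j) p \<noteq> 0" using elim by (cases p) (auto simp: hcoord_def inner_axis)
    then show ?case by (auto simp: hsq_def sum_nonneg_eq_0_iff)
  qed
qed

context weighted_heis
begin

lemma borel_measurable_weighted:
  assumes "continuous_on \<Omega> c"
  shows "(\<lambda>p. indicator \<Omega> p * (c p * (W p * F p))) \<in> borel_measurable lebesgue"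
proof -
  have "(\<lambda>p. if p \<in> \<Omega> then c p * W p else 0) \<in> borel_measurable borel"
    by (intro borel_measurable_continuous_on_if continuous_intros continuous_on_g_norm assms sets_\<Omega>(2))
  then have "(\<lambda>p. if p \<in> \<Omega> then c p * W p else 0) \<in> borel_measurable lebesgue"
    by (simp add: measurable_completion)
  then have "(\<lambda>p. (if p \<in> \<Omega> then c p * W p else 0) * \<bar>indicator \<Omega> p * f p\<bar> powr q) \<in> borel_measurable lebesgue"
    by (intro borel_measurable_times powr_real_measurable borel_measurable_abs f_meas borel_measurable_const)
  also have "(\<lambda>p. (if p \<in> \<Omega> then c p * W p else 0) * \<bar>indicator \<Omega> p * f p\<bar> powr q) =
      (\<lambda>p. indicator \<Omega> p * (c p * (W p * F p)))"
    by (auto simp: fun_eq_iff)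
  finally show ?thesis .
qed

lemma borel_measurable_weighted_subgrad:
  "(\<lambda>p. indicator \<Omega> p * (W p * subgrad_norm \<iota> f p powr q)) \<in> borel_measurable lebesgue"
proof -
  have "(\<lambda>p. if p \<in> \<Omega> then W p else 0) \<in> borel_measurable borel"
    by (intro borel_measurable_continuous_on_if continuous_intros continuous_on_g_norm sets_\<Omega>(2))
  then have "(\<lambda>p. if p \<in> \<Omega> then W p else 0) \<in> borel_measurable lebesgue"
    by (simp add: measurable_completion)
  then have "(\<lambda>p. (if p \<in> \<Omega> then W p else 0) * (indicator \<Omega> p * subgrad_norm \<iota> f p) powr q) \<in> borel_measurable lebesgue"
    by (intro borel_measurable_times powr_real_measurable borel_measurable_subgrad borel_measurable_const)
  also have "(\<lambda>p. (if p \<in> \<Omega> then W p else 0) * (indicator \<Omega> p * subgrad_norm \<iota> f p) powr q) =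
      (\<lambda>p. indicator \<Omega> p * (W p * subgrad_norm \<iota> f p powr q))"
    by (auto simp: fun_eq_iff)
  finally show ?thesis .
qed

text \<open>Fatou's lemma removes both the outer cutoff and the regularisation \<open>\<epsilon>\<close> at the vertical axis.\<close>

lemma limit_estimate:
  assumes intF: "integrable lebesgue (\<lambda>p. indicator \<Omega> p * (W p * F p))"
    and intG: "integrable lebesgue (\<lambda>p. indicator \<Omega> p * (W p * subgrad_norm \<iota> f p powr q))"
  shows "(\<integral>\<^sup>+p. ennreal (indicator \<Omega> p * (cutoff_in (heis_rho \<iota> p) * g' (heis_norm \<iota> p) * heis_norm \<iota> p
        * (heis_B \<iota> p / heis_rho \<iota> p / hsq p) * (W p * F p))) \<partial>lebesgue)
    \<le> ennreal (72 * q\<^sup>2 * (LINT p|lebesgue. indicator \<Omega> p * (W p * subgrad_norm \<iota> f p powr q))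
       + (72 * q\<^sup>2 + 24 * real CARD('n) + 120) * (LINT p|lebesgue. indicator \<Omega> p * (W p * F p)))"
    (is "_ \<le> ?R")
proof -
  define d where "d = (\<lambda>i. inverse (real (Suc i)))"
  have d: "0 < d i" "d i \<le> 1" for i by (auto simp: d_def inverse_le_1_iff)
  have d0: "d \<longlonglongrightarrow> 0" unfolding d_def by (rule LIMSEQ_inverse_real_of_nat)
  define c where "c = (\<lambda>i p. cutoff_in (heis_rho \<iota> p) * cutoff_out (d i) (heis_rho \<iota> p) * g' (heis_norm \<iota> p)
    * heis_norm \<iota> p * (heis_B \<iota> p / heis_rho \<iota> p / (hsq p + d i)))"
  define L where "L = (\<lambda>i p. ennreal (indicator \<Omega> p * (c i p * (W p * F p))))"
  have "continuous_on \<Omega> (c i)" for i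
    unfolding c_def cutoff_in_def cutoff_out_def
    using hsq_add_ne_0[OF d(1)[of i]]
    by (intro continuous_intros continuous_on_norm continuous_on_g'_norm) (auto simp: one_plus_sq_pos)
  then have L_meas: "L i \<in> borel_measurable lebesgue" for i
    unfolding L_def by (intro measurable_compose[OF borel_measurable_weighted measurable_ennreal])
  have "(\<lambda>i. L i p) \<longlonglongrightarrow> ennreal (indicator \<Omega> p * (cutoff_in (heis_rho \<iota> p) * g' (heis_norm \<iota> p) * heis_norm \<iota> p
        * (heis_B \<iota> p / heis_rho \<iota> p / hsq p) * (W p * F p)))" for p
  proof -
    have out: "(\<lambda>i. cutoff_out (d i) (heis_rho \<iota> p)) \<longlonglongrightarrow> (max 0 (1 - 0 * heis_rho \<iota> p))\<^sup>2"
      unfolding cutoff_out_def by (intro tendsto_intros d0)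
    \<comment> \<open>On the axis \<open>B\<close> vanishes together with \<open>hsq\<close>, and
      division by zero yields zero, so the convergence holds at every point.\<close>
    have B: "(\<lambda>i. heis_B \<iota> p / heis_rho \<iota> p / (hsq p + d i)) \<longlonglongrightarrow> heis_B \<iota> p / heis_rho \<iota> p / hsq p"
    proof (cases "hsq p = 0")
      case True
      then have "heis_B \<iota> p = 0" using two_heis_B_le_hsq[of \<iota> p] heis_B_nonneg[of \<iota> p] by linarith
      then show ?thesis by simp
    next
      case False
      have "(\<lambda>i. heis_B \<iota> p / heis_rho \<iota> p / (hsq p + d i)) \<longlonglongrightarrow> heis_B \<iota> p / heis_rho \<iota> p / (hsq p + 0)"
        using False by (intro tendsto_intros d0) auto
      then show ?thesis by simp
    qed
    have "(\<lambda>i. indicator \<Omega> p * (c i p * (W p * F p))) \<longlonglongrightarrow>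
      indicator \<Omega> p * ((cutoff_in (heis_rho \<iota> p) * (max 0 (1 - 0 * heis_rho \<iota> p))\<^sup>2 * g' (heis_norm \<iota> p)
    * heis_norm \<iota> p * (heis_B \<iota> p / heis_rho \<iota> p / hsq p)) * (W p * F p))"
      unfolding c_def by (intro tendsto_mult tendsto_const out B)
    then show ?thesis unfolding L_def by (intro tendsto_ennrealI) simp
  qed
  then have "(\<integral>\<^sup>+p. ennreal (indicator \<Omega> p * (cutoff_in (heis_rho \<iota> p) * g' (heis_norm \<iota> p) * heis_norm \<iota> p
        * (heis_B \<iota> p / heis_rho \<iota> p / hsq p) * (W p * F p))) \<partial>lebesgue) =
      (\<integral>\<^sup>+p. liminf (\<lambda>i. L i p) \<partial>lebesgue)"
    by (intro nn_integral_cong lim_imp_Liminf[symmetric] sequentially_bot)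
  also have "\<dots> \<le> liminf (\<lambda>i. \<integral>\<^sup>+p. L i p \<partial>lebesgue)"
    by (rule nn_integral_liminf) (rule L_meas)
  also have "\<dots> \<le> liminf (\<lambda>i::nat. ?R)"
  proof (intro Liminf_mono always_eventually allI)
    fix i
    show "(\<integral>\<^sup>+p. L i p \<partial>lebesgue) \<le> ?R"
      unfolding L_def c_def
      by (rule cutoff_estimate[where \<psi> = "\<lambda>x. cutoff_in x * cutoff_out (d i) x" and \<psi>' = "cutoff_deriv (d i)"
            and R = "1 / d i", OF has_real_derivative_cutoff continuous_cutoff_deriv cutoff_bounds
            abs_cutoff_deriv_le cutoff_support d(1) intF intG])
        (use d(1)[of i] d(2)[of i] in auto)
  qed
  also have "\<dots> = ?R" by (rule Liminf_const) simp
  finally show ?thesis .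
qed

text \<open>The factor 16 is \<open>2 * 4 * 2\<close>, from \<open>cutoff_in >= 1 / 2\<close>,
  \<open>B / |x|^2 >= 1 / 4\<close> and \<open>N / \<rho> >= 1 / (2 N^2)\<close> on
  \<open>\<rho> >= 4\<close>.\<close>

lemma tail_bound:
  "(\<integral>\<^sup>+p. ennreal (indicator {p. 4 \<le> heis_rho \<iota> p} p * (g' (heis_norm \<iota> p) / (heis_norm \<iota> p)\<^sup>2 * (W p * F p))) \<partial>lebesgue)
    \<le> ennreal (16 * (72 * q\<^sup>2)) * (\<integral>\<^sup>+p. ennreal (indicator \<Omega> p * (W p * subgrad_norm \<iota> f p powr q)) \<partial>lebesgue)
     + ennreal (16 * (72 * q\<^sup>2 + 24 * real CARD('n) + 120)) * (\<integral>\<^sup>+p. ennreal (indicator \<Omega> p * (W p * F p)) \<partial>lebesgue)"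
  (is "?L \<le> ennreal (16 * ?C) * ?G + ennreal (16 * ?D) * ?F")
proof (cases "?G < \<infinity> \<and> ?F < \<infinity>")
  case False
  \<comment> \<open>Both constants are positive, so an infinite integral makes the right-hand side
    infinite; otherwise both functions are integrable and \<open>limit_estimate\<close>
    applies.\<close>
  have "0 < ?C" "0 < ?D" using q by (auto intro!: add_pos_pos add_nonneg_pos)
  then have "ennreal (16 * ?C) * ?G + ennreal (16 * ?D) * ?F = \<infinity>"
    using False by (auto simp: ennreal_mult_eq_top_iff top.not_eq_extremum[symmetric])
  then show ?thesis by (simp only: infinity_ennreal_def top_greatest)
next
  case True
  have m: "(\<lambda>p. indicator \<Omega> p * (W p * F p)) \<in> borel_measurable lebesgue"
    using borel_measurable_weighted[of "\<lambda>_. 1"] by simp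
  have nnF: "AE p in lebesgue. 0 \<le> indicator \<Omega> p * (W p * F p)"
    and nnG: "AE p in lebesgue. 0 \<le> indicator \<Omega> p * (W p * subgrad_norm \<iota> f p powr q)"
    by simp_all
  have intF: "integrable lebesgue (\<lambda>p. indicator \<Omega> p * (W p * F p))"
    using True by (intro integrableI_nonneg m nnF) auto
  have intG: "integrable lebesgue (\<lambda>p. indicator \<Omega> p * (W p * subgrad_norm \<iota> f p powr q))"
    using True by (intro integrableI_nonneg borel_measurable_weighted_subgrad nnG) auto
  let ?c = "\<lambda>p. cutoff_in (heis_rho \<iota> p) * g' (heis_norm \<iota> p) * heis_norm \<iota> p
        * (heis_B \<iota> p / heis_rho \<iota> p / hsq p)"
  let ?f = "\<lambda>p. indicator \<Omega> p * (?c p * (W p * F p))"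
  have "?L \<le> (\<integral>\<^sup>+p. ennreal (16 * ?f p) \<partial>lebesgue)"
  proof (rule nn_integral_mono_AE)
    show "AE p in lebesgue. ennreal (indicator {p. 4 \<le> heis_rho \<iota> p} p * (g' (heis_norm \<iota> p) / (heis_norm \<iota> p)\<^sup>2 * (W p * F p)))
       \<le> ennreal (16 * ?f p)"
      using AE_hsq_nonzero
    proof eventually_elim
      case (elim p)
      show ?case
      proof (cases "4 \<le> heis_rho \<iota> p")
        case True
        define N \<rho> where "N = heis_norm \<iota> p" and "\<rho> = heis_rho \<iota> p"
        have \<rho>: "4 \<le> \<rho>" and N: "1 < N" "\<rho> / 2 \<le> N\<^sup>2"
          using True one_less_heis_norm[of \<iota> p] heis_norm_sq_bounds[of \<iota> p] by (auto simp: N_def \<rho>_def)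
        have h: "0 < hsq p" using elim hsq_nonneg[of p] by linarith
        have "1 \<le> (max 0 (\<rho> - 3))\<^sup>2" using \<rho> by simp
        then have c1: "1 / 2 \<le> cutoff_in \<rho>" by (simp add: cutoff_in_def field_simps)
        have c2: "1 / 4 \<le> heis_B \<iota> p / hsq p" using h hsq_le_four_heis_B[of p \<iota>] by (simp add: field_simps)
        have nn: "0 \<le> cutoff_in \<rho> * (heis_B \<iota> p / hsq p)"
          using h heis_B_nonneg[of \<iota> p] cutoff_in_bounds(1)[of \<rho>] by simp
        \<comment> \<open>From \<open>\<rho> <= 2 N^2\<close>; since \<open>N > 1\<close>, the extra
          factor \<open>N\<close> in the numerator may be dropped.\<close>
        have c3: "1 / (2 * N\<^sup>2) \<le> N / \<rho>"
        proof -
          have "1 / (2 * N\<^sup>2) \<le> 1 / \<rho>" using N \<rho> by (intro divide_left_mono) auto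
          also have "\<dots> \<le> N / \<rho>" using N \<rho> by (intro divide_right_mono) auto
          finally show ?thesis .
        qed
        have "1 / 2 * (1 / 4) * (1 / (2 * N\<^sup>2)) \<le> cutoff_in \<rho> * (heis_B \<iota> p / hsq p) * (N / \<rho>)"
          using c1 c2 c3 N nn by (intro mult_mono) auto
        then have "1 / N\<^sup>2 \<le> 16 * (cutoff_in \<rho> * (heis_B \<iota> p / hsq p) * (N / \<rho>))" by simp
        then have "1 / N\<^sup>2 * (g' N * (W p * F p)) \<le> 16 * (cutoff_in \<rho> * (heis_B \<iota> p / hsq p) * (N / \<rho>)) * (g' N * (W p * F p))"
          using g'_nonneg[OF N(1)] by (intro mult_right_mono) auto
        then show ?thesis using True
          by (intro ennreal_leI) (simp add: N_def[symmetric] \<rho>_def[symmetric] mult_ac)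
      qed simp
    qed
  qed
  also have "\<dots> = ennreal 16 * (\<integral>\<^sup>+p. ennreal (?f p) \<partial>lebesgue)"
  proof (subst nn_integral_cmult[symmetric])
    have "continuous_on \<Omega> (\<lambda>p. cutoff_in (heis_rho \<iota> p) * g' (heis_norm \<iota> p) * heis_norm \<iota> p * (heis_B \<iota> p / heis_rho \<iota> p))"
      unfolding cutoff_in_def
      by (intro continuous_intros continuous_on_norm continuous_on_g'_norm) (auto simp: one_plus_sq_pos)
    moreover have "hsq \<in> borel_measurable (lebesgue :: 'n heis measure)"
      using borel_measurable_continuous_onI[OF continuous_on_hsq] by (intro measurable_completion) simp
    ultimately have "(\<lambda>p. indicator \<Omega> p * (cutoff_in (heis_rho \<iota> p) * g' (heis_norm \<iota> p) * heis_norm \<iota> p * (heis_B \<iota> p / heis_rho \<iota> p)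
       * (W p * F p)) / hsq p) \<in> borel_measurable lebesgue"
      by (intro borel_measurable_divide borel_measurable_weighted)
    then have "?f \<in> borel_measurable lebesgue" by (simp add: mult_ac)
    then show "(\<lambda>p. ennreal (?f p)) \<in> borel_measurable lebesgue" by simp
    show "(\<integral>\<^sup>+p. ennreal (16 * ?f p) \<partial>lebesgue) = (\<integral>\<^sup>+p. ennreal 16 * ennreal (?f p) \<partial>lebesgue)"
      by (intro nn_integral_cong) (rule ennreal_mult', simp)
  qed
  also have "\<dots> \<le> ennreal 16 * ennreal (?C * (LINT p|lebesgue. indicator \<Omega> p * (W p * subgrad_norm \<iota> f p powr q))
       + ?D * (LINT p|lebesgue. indicator \<Omega> p * (W p * F p)))"
    by (intro mult_left_mono limit_estimate intF intG) simp
  also have "\<dots> = ennreal (16 * ?C) * ?G + ennreal (16 * ?D) * ?F"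
  proof -
    have scale: "ennreal 16 * ennreal (a * x + b * y) = ennreal (16 * a) * ennreal x + ennreal (16 * b) * ennreal y"
      if "0 \<le> a" "0 \<le> b" "0 \<le> x" "0 \<le> y" for a b x y
    proof -
      have "ennreal 16 * ennreal (a * x + b * y) = ennreal ((16 * a) * x + (16 * b) * y)"
        by (subst ennreal_mult'[symmetric]) (simp_all add: algebra_simps)
      also have "\<dots> = ennreal ((16 * a) * x) + ennreal ((16 * b) * y)"
        using that by (intro ennreal_plus) auto
      finally show ?thesis using that by (simp only: ennreal_mult' mult_nonneg_nonneg zero_le_numeral)
    qed
    show ?thesis
      unfolding nn_integral_eq_integral[OF intF nnF] nn_integral_eq_integral[OF intG nnG]
      by (rule scale) (auto intro: integral_nonneg_AE[OF nnF] integral_nonneg_AE[OF nnG])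
  qed
  finally show ?thesis .
qed

end

section \<open>Measurability of the norm, and the inequality for \<open>\<mu>\<close>\<close>

lemma borel_measurable_heis_norm: "heis_norm \<iota> \<in> borel_measurable borel"
proof -
  have [measurable]: "hsq \<in> borel_measurable borel" "heis_B \<iota> \<in> borel_measurable borel"
    "heis_rho \<iota> \<in> borel_measurable borel"
    by (intro borel_measurable_continuous_onI continuous_intros)+
  have "heis_norm \<iota> p = (if heis_rho \<iota> p = 0 then 0 else exp (log_norm \<iota> p))" for p
  proof (cases "heis_rho \<iota> p = 0")
    case True
    \<comment> \<open>At \<open>\<rho> = 0\<close> the formula itself evaluates to 0, because
      \<open>0 powr\<close> anything is 0; hence splitting on \<open>\<rho>\<close> agrees with the
      definition.\<close>
    then have "(heis_B \<iota> p)\<^sup>2 + (snd (snd p))\<^sup>2 = 0" by (simp add: heis_rho_def vert_def)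
    then show ?thesis using True by (simp add: heis_norm_def Let_def)
  qed (use heis_rho_nonneg[of \<iota> p] in \<open>simp add: heis_norm_eq_exp\<close>)
  then have "heis_norm \<iota> = (\<lambda>p. if heis_rho \<iota> p = 0 then 0 else exp (log_norm \<iota> p))"
    by auto
  also have "\<dots> \<in> borel_measurable borel"
    unfolding log_norm_def Let_def by measurable
  finally show ?thesis .
qed

lemma heis_norm_nonneg: "0 \<le> heis_norm \<iota> p"
proof (cases "p = 0")
  case False
  have "0 \<le> heis_B \<iota> p + sqrt ((heis_B \<iota> p)\<^sup>2 + (snd (snd p))\<^sup>2)"
    using heis_B_nonneg[of \<iota> p] by simp
  then show ?thesis using False by (simp add: heis_norm_def Let_def)
qed (simp add: heis_norm_def)

theorem theorem3:
  fixes \<iota> :: "'n::finite"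
    and g g' g'' :: "real \<Rightarrow> real"
    and Z q :: real
    and \<mu> :: "'n heis measure"
  assumes "CARD('n) > 5"
    and "\<And>r. 0 \<le> r \<Longrightarrow> 0 \<le> g r"
    and "mono_on {0..} g"
    and "\<And>r. 0 \<le> r \<Longrightarrow> (g has_real_derivative g' r) (at r within {0..})"
    and "\<And>r. 1 \<le> r \<Longrightarrow> (g' has_real_derivative g'' r) (at r within {1..})"
    and "\<And>p::'n heis. 1 \<le> heis_norm \<iota> p \<Longrightarrow> g'' (heis_norm \<iota> p) \<le> (g' (heis_norm \<iota> p))\<^sup>2"
    and "Z = (LINT p|lebesgue. exp (- g (heis_norm \<iota> p)))"
    and "\<mu> = density lebesgue (\<lambda>p. ennreal (exp (- g (heis_norm \<iota> p)) / Z))"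
    and "prob_space \<mu>"
    and "2 \<le> q"
  shows "\<exists>C D :: real. 0 < C \<and> 0 < D \<and> (\<forall>f. admissible \<iota> f \<longrightarrow>
    (\<integral>\<^sup>+p\<in>{p. 1 \<le> heis_norm \<iota> p}.
        ennreal (g' (heis_norm \<iota> p) / (heis_norm \<iota> p)\<^sup>2 * \<bar>f p\<bar> powr q) \<partial>\<mu>)
    \<le> ennreal C * (\<integral>\<^sup>+p\<in>{p. 1 \<le> heis_norm \<iota> p}. ennreal (subgrad_norm \<iota> f p powr q) \<partial>\<mu>)
      + ennreal D * (\<integral>\<^sup>+p\<in>{p. 1 \<le> heis_norm \<iota> p}. ennreal (\<bar>f p\<bar> powr q) \<partial>\<mu>))"
proof -
  define A \<Omega> where "A = {p. 1 \<le> heis_norm \<iota> p}" and "\<Omega> = {p. 2 < heis_rho \<iota> p}"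
  define N W where "N = heis_norm \<iota>" and "W = (\<lambda>p. exp (- g (N p)))"
  have interior: "(g has_real_derivative g' r) (at r)" if "0 < r" for r
    using assms(4)[of r] that at_within_interior[of r "{0..}"] by auto
  have g'_nonneg: "0 \<le> g' r" if "1 \<le> r" for r
    using mono_on_imp_deriv_nonneg[OF assms(3) interior[of r]] that by auto
  have g'_cont: "continuous_on {1..} g'"
    using assms(5) by (intro DERIV_continuous_on) auto
  \<comment> \<open>The interval up to 3 covers the layer \<open>\<rho> < 4\<close> of the region,
    where \<open>N^2 <= 2 \<rho> < 9\<close>.\<close>
  then have "continuous_on {1..3} g'" by (rule continuous_on_subset) auto
  from bounded_on_compact[OF compact_Icc this]
  obtain M where M: "0 \<le> M" "\<And>r. r \<in> {1..3} \<Longrightarrow> \<bar>g' r\<bar> \<le> M" by blast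
  have Z: "0 \<le> Z" unfolding assms(7) by (rule integral_nonneg_AE) simp
  have \<Omega>A: "\<Omega> \<subseteq> A"
    unfolding \<Omega>_def A_def using one_less_heis_norm by fastforce
  have Nm[measurable]: "N \<in> borel_measurable lebesgue"
    unfolding N_def using borel_measurable_heis_norm by (intro measurable_completion) simp
  have [measurable]: "A \<in> sets lebesgue" "\<Omega> \<in> sets lebesgue"
  proof -
    have "A = N -` {1..} \<inter> space lebesgue" by (auto simp: A_def N_def)
    also have "\<dots> \<in> sets lebesgue" by (rule measurable_sets[OF Nm]) simp
    finally show "A \<in> sets lebesgue" .
    show "\<Omega> \<in> sets lebesgue" unfolding \<Omega>_def using open_rho_greater[of 2 \<iota>] by auto
  qed
  have Wm[measurable]: "W \<in> borel_measurable lebesgue"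
  proof -
    have "continuous_on {0..} g" using assms(4) by (intro DERIV_continuous_on) auto
    \<comment> \<open>\<open>g\<close> is arbitrary at negative arguments, so a truncation is
      composed with the nonnegative norm.\<close>
    then have "(\<lambda>r. if r \<in> {0..} then g r else 0) \<in> borel_measurable borel"
      by (intro borel_measurable_continuous_on_if) (auto intro: continuous_intros)
    from measurable_compose[OF Nm this] have "(\<lambda>p. g (N p)) \<in> borel_measurable lebesgue"
      by (simp add: N_def heis_norm_nonneg)
    then show ?thesis unfolding W_def by measurable
  qed
  \<comment> \<open>Stated for a general set \<open>S\<close> because the subgradient is known to be
    measurable only on \<open>\<Omega>\<close>, not on all of \<open>A\<close>.\<close>
  have dens: "(\<integral>\<^sup>+p\<in>S. ennreal (u p) \<partial>\<mu>) = ennreal (1 / Z) * (\<integral>\<^sup>+p. ennreal (indicator S p * (W p * u p)) \<partial>lebesgue)"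
    if [measurable]: "S \<in> sets lebesgue" and m[measurable]: "(\<lambda>p. indicator S p * u p) \<in> borel_measurable lebesgue" for S u
  proof -
    have "(\<integral>\<^sup>+p\<in>S. ennreal (u p) \<partial>\<mu>) = (\<integral>\<^sup>+p. ennreal (indicator S p * u p) \<partial>\<mu>)"
      by (intro nn_integral_cong) (simp add: indicator_def)
    also have "\<dots> = (\<integral>\<^sup>+p. ennreal (W p / Z) * ennreal (indicator S p * u p) \<partial>lebesgue)"
      unfolding assms(8) N_def[symmetric] W_def[THEN fun_cong, symmetric]
      by (intro nn_integral_density) measurable
    also have "\<dots> = (\<integral>\<^sup>+p. ennreal (1 / Z) * ennreal (W p * (indicator S p * u p)) \<partial>lebesgue)"
      using Z by (intro nn_integral_cong) (simp add: ennreal_mult'[symmetric] W_def)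
    also have "\<dots> = ennreal (1 / Z) * (\<integral>\<^sup>+p. ennreal (W p * (indicator S p * u p)) \<partial>lebesgue)"
      by (intro nn_integral_cmult) measurable
    finally show ?thesis by (simp only: mult.left_commute)
  qed
  \<comment> \<open>16 times the constants of the tail estimate, plus \<open>M\<close> for the layer
    \<open>\<rho> < 4\<close>; all are fixed before \<open>f\<close> is chosen.\<close>
  define C D where "C = 16 * (72 * q\<^sup>2)" and "D = 16 * (72 * q\<^sup>2 + 24 * real CARD('n) + 120) + M"
  have CD: "0 < C" "0 < D"
  proof -
    have "0 \<le> 72 * q\<^sup>2 + 24 * real CARD('n)" by simp
    then show "0 < D" unfolding D_def using M(1) by argo
  qed (use assms(10) in \<open>simp add: C_def\<close>)
  have main: "(\<integral>\<^sup>+p\<in>A. ennreal (g' (N p) / (N p)\<^sup>2 * \<bar>f p\<bar> powr q) \<partial>\<mu>)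
    \<le> ennreal C * (\<integral>\<^sup>+p\<in>A. ennreal (subgrad_norm \<iota> f p powr q) \<partial>\<mu>)
      + ennreal D * (\<integral>\<^sup>+p\<in>A. ennreal (\<bar>f p\<bar> powr q) \<partial>\<mu>)" if f: "admissible \<iota> f" for f
  proof -
    have "f \<in> borel_measurable (lebesgue_on A)" using f by (simp add: admissible_def A_def)
    then have fA[measurable]: "(\<lambda>p. indicator A p * f p) \<in> borel_measurable lebesgue"
      by (subst (asm) borel_measurable_restrict_space_iff) auto
    have "(\<lambda>p. indicator \<Omega> p * f p) = (\<lambda>p. indicator \<Omega> p * (indicator A p * f p))"
      using \<Omega>A by (auto simp: indicator_def fun_eq_iff)
    also have "\<dots> \<in> borel_measurable lebesgue" by measurable
    finally have fm: "(\<lambda>p. indicator \<Omega> p * f p) \<in> borel_measurable lebesgue" .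
    interpret hs: weighted_heis \<iota> g g' q f
    proof
      show "continuous_on {1<..} g'" by (rule continuous_on_subset[OF g'_cont]) auto
      show "horizontally_differentiable_at \<iota> f p" if "2 < heis_rho \<iota> p" for p
        using f one_less_heis_norm[OF that] unfolding admissible_def by blast
      show "(\<lambda>p. indicator {p. 2 < heis_rho \<iota> p} p * f p) \<in> borel_measurable lebesgue"
        using fm by (simp add: \<Omega>_def)
    qed (use assms(1,10) interior g'_nonneg in auto)
    have Fm[measurable]: "(\<lambda>p. indicator A p * \<bar>f p\<bar> powr q) \<in> borel_measurable lebesgue"
    proof -
      have "(\<lambda>p. indicator A p * \<bar>f p\<bar> powr q) = (\<lambda>p. \<bar>indicator A p * f p\<bar> powr q)"
        by (auto simp: indicator_def fun_eq_iff)
      then show ?thesis by simp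
    qed
    have \<phi>m[measurable]: "(\<lambda>p. indicator A p * (g' (N p) / (N p)\<^sup>2 * \<bar>f p\<bar> powr q)) \<in> borel_measurable lebesgue"
    proof -
      have "(\<lambda>r. if r \<in> {1..} then g' r else 0) \<in> borel_measurable borel"
        by (intro borel_measurable_continuous_on_if g'_cont) (auto intro: continuous_intros)
      from measurable_compose[OF Nm this]
      have [measurable]: "(\<lambda>p. if N p \<in> {1..} then g' (N p) else 0) \<in> borel_measurable lebesgue" .
      have "(\<lambda>p. indicator A p * (g' (N p) / (N p)\<^sup>2 * \<bar>f p\<bar> powr q)) =
          (\<lambda>p. (if N p \<in> {1..} then g' (N p) else 0) / (N p)\<^sup>2 * (indicator A p * \<bar>f p\<bar> powr q))"
        by (auto simp: A_def N_def indicator_def fun_eq_iff)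
      also have "\<dots> \<in> borel_measurable lebesgue" by measurable
      finally show ?thesis .
    qed
    have Gm: "(\<lambda>p. indicator \<Omega> p * subgrad_norm \<iota> f p powr q) \<in> borel_measurable lebesgue"
    proof -
      have "(\<lambda>p. indicator \<Omega> p * subgrad_norm \<iota> f p powr q) = (\<lambda>p. (indicator \<Omega> p * subgrad_norm \<iota> f p) powr q)"
        by (auto simp: indicator_def fun_eq_iff)
      also have "\<dots> \<in> borel_measurable lebesgue"
        using hs.borel_measurable_subgrad unfolding \<Omega>_def by simp
      finally show ?thesis .
    qed
    let ?K = "{p. 4 \<le> heis_rho \<iota> p}"
    have [measurable]: "?K \<in> sets lebesgue"
      using closed_Collect_le[OF continuous_on_const continuous_on_heis_rho, of 4 \<iota>] by auto
    let ?F = "\<integral>\<^sup>+p. ennreal (indicator A p * (W p * \<bar>f p\<bar> powr q)) \<partial>lebesgue"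
    let ?G = "\<integral>\<^sup>+p. ennreal (indicator \<Omega> p * (W p * subgrad_norm \<iota> f p powr q)) \<partial>lebesgue"
    let ?T = "\<lambda>p. indicator ?K p * (g' (N p) / (N p)\<^sup>2 * (W p * \<bar>f p\<bar> powr q))"
    have KA: "?K \<subseteq> A" using \<Omega>A by (auto simp: \<Omega>_def)
    \<comment> \<open>Split \<open>A\<close> at \<open>\<rho> = 4\<close>: beyond it the term
      \<open>?T\<close> takes over, and in the layer \<open>1 <= N <= 3\<close> the factor
      \<open>g'(N) / N^2\<close> is at most \<open>M\<close>.\<close>
    have near: "ennreal (indicator A p * (W p * (g' (N p) / (N p)\<^sup>2 * \<bar>f p\<bar> powr q)))
        \<le> ennreal (?T p) + ennreal M * ennreal (indicator A p * (W p * \<bar>f p\<bar> powr q))" for p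
    proof (cases "p \<in> A \<and> p \<notin> ?K")
      case True
      then have N: "1 \<le> N p" "heis_rho \<iota> p < 4" by (auto simp: A_def N_def)
      have "0 < heis_rho \<iota> p"
      proof (rule ccontr)
        assume "\<not> 0 < heis_rho \<iota> p"
        then have "heis_rho \<iota> p = 0" using heis_rho_nonneg[of \<iota> p] by simp
        then have "(heis_B \<iota> p)\<^sup>2 + (snd (snd p))\<^sup>2 = 0" by (simp add: heis_rho_def vert_def)
        then show False using N by (simp add: N_def heis_norm_def Let_def split: if_splits)
      qed
      then have "(N p)\<^sup>2 \<le> 3\<^sup>2" using heis_norm_sq_bounds(2)[of \<iota> p] N by (simp add: N_def)
      then have N3: "N p \<le> 3" by (rule power2_le_imp_le) simp
      have "g' (N p) / (N p)\<^sup>2 \<le> g' (N p) / 1"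
        using N g'_nonneg[OF N(1)] by (intro divide_left_mono) auto
      also have "\<dots> \<le> M" using M(2)[of "N p"] N N3 by auto
      finally have "g' (N p) / (N p)\<^sup>2 * (W p * \<bar>f p\<bar> powr q) \<le> M * (W p * \<bar>f p\<bar> powr q)"
        by (intro mult_right_mono) (auto simp: W_def)
      then have "ennreal (indicator A p * (W p * (g' (N p) / (N p)\<^sup>2 * \<bar>f p\<bar> powr q)))
        \<le> ennreal (M * (indicator A p * (W p * \<bar>f p\<bar> powr q)))"
        using True by (intro ennreal_leI) (simp add: mult_ac)
      then show ?thesis using M(1) by (simp add: ennreal_mult' add_increasing)
    next
      case False
      then have "indicator A p * (W p * (g' (N p) / (N p)\<^sup>2 * \<bar>f p\<bar> powr q)) \<le> ?T p"
        using g'_nonneg[of "N p"] subsetD[OF KA, of p] by (cases "p \<in> ?K") (auto simp: W_def A_def N_def mult_ac indicator_def)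
      then have "ennreal (indicator A p * (W p * (g' (N p) / (N p)\<^sup>2 * \<bar>f p\<bar> powr q))) \<le> ennreal (?T p)"
        by (rule ennreal_leI)
      then show ?thesis by (simp add: add_increasing2)
    qed
    have Tm: "?T \<in> borel_measurable lebesgue"
    proof -
      have "?T = (\<lambda>p. indicator ?K p * W p * (indicator A p * (g' (N p) / (N p)\<^sup>2 * \<bar>f p\<bar> powr q)))"
        using KA by (auto simp: indicator_def fun_eq_iff)
      also have "\<dots> \<in> borel_measurable lebesgue" by measurable
      finally show ?thesis .
    qed
    have WFm: "(\<lambda>p. indicator A p * (W p * \<bar>f p\<bar> powr q)) \<in> borel_measurable lebesgue"
    proof -
      have "(\<lambda>p. W p * (indicator A p * \<bar>f p\<bar> powr q)) \<in> borel_measurable lebesgue" by measurable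
      then show ?thesis by (simp only: mult.left_commute)
    qed
    have "(\<integral>\<^sup>+p. ennreal (indicator A p * (W p * (g' (N p) / (N p)\<^sup>2 * \<bar>f p\<bar> powr q))) \<partial>lebesgue)
      \<le> (\<integral>\<^sup>+p. ennreal (?T p) + ennreal M * ennreal (indicator A p * (W p * \<bar>f p\<bar> powr q)) \<partial>lebesgue)"
      by (intro nn_integral_mono near)
    also have "\<dots> = (\<integral>\<^sup>+p. ennreal (?T p) \<partial>lebesgue) + ennreal M * ?F"
      using Tm WFm by (subst nn_integral_add) (auto simp: nn_integral_cmult)
    also have "(\<integral>\<^sup>+p. ennreal (?T p) \<partial>lebesgue) \<le> ennreal C * ?G + ennreal (D - M) *
        (\<integral>\<^sup>+p. ennreal (indicator \<Omega> p * (W p * \<bar>f p\<bar> powr q)) \<partial>lebesgue)"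
      using hs.tail_bound unfolding C_def D_def \<Omega>_def W_def N_def by simp
    also have "(\<integral>\<^sup>+p. ennreal (indicator \<Omega> p * (W p * \<bar>f p\<bar> powr q)) \<partial>lebesgue) \<le> ?F"
      using \<Omega>A by (intro nn_integral_mono ennreal_leI) (auto simp: indicator_def W_def)
    also have "ennreal C * ?G + ennreal (D - M) * ?F + ennreal M * ?F = ennreal C * ?G + ennreal D * ?F"
    proof -
      have "0 \<le> D - M" by (simp add: D_def)
      then have "ennreal (D - M) + ennreal M = ennreal D" using M(1) by (simp add: ennreal_plus[symmetric] del: ennreal_plus)
      then show ?thesis by (simp add: add.assoc distrib_right[symmetric])
    qed
    finally have est: "(\<integral>\<^sup>+p. ennreal (indicator A p * (W p * (g' (N p) / (N p)\<^sup>2 * \<bar>f p\<bar> powr q))) \<partial>lebesgue)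
      \<le> ennreal C * ?G + ennreal D * ?F" by (simp add: mult_left_mono add_mono)
    have "(\<integral>\<^sup>+p\<in>A. ennreal (g' (N p) / (N p)\<^sup>2 * \<bar>f p\<bar> powr q) \<partial>\<mu>) \<le> ennreal (1 / Z) * (ennreal C * ?G + ennreal D * ?F)"
      unfolding dens[OF \<open>A \<in> sets lebesgue\<close> \<phi>m] by (intro mult_left_mono est) simp
    also have "\<dots> = ennreal C * (ennreal (1 / Z) * ?G) + ennreal D * (ennreal (1 / Z) * ?F)"
      by (simp add: distrib_left mult_ac)
    also have "ennreal (1 / Z) * ?F = (\<integral>\<^sup>+p\<in>A. ennreal (\<bar>f p\<bar> powr q) \<partial>\<mu>)"
      by (rule dens[OF \<open>A \<in> sets lebesgue\<close> Fm, symmetric])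
    also have "ennreal (1 / Z) * ?G = (\<integral>\<^sup>+p\<in>\<Omega>. ennreal (subgrad_norm \<iota> f p powr q) \<partial>\<mu>)"
      by (rule dens[OF \<open>\<Omega> \<in> sets lebesgue\<close> Gm, symmetric])
    \<comment> \<open>Only monotonicity of the integral is used to enlarge \<open>\<Omega>\<close>
      to \<open>A\<close>, in keeping with the measurability available for the subgradient.\<close>
    also have "ennreal C * (\<integral>\<^sup>+p\<in>\<Omega>. ennreal (subgrad_norm \<iota> f p powr q) \<partial>\<mu>)
        \<le> ennreal C * (\<integral>\<^sup>+p\<in>A. ennreal (subgrad_norm \<iota> f p powr q) \<partial>\<mu>)"
      using \<Omega>A by (intro mult_left_mono nn_integral_mono) (auto simp: indicator_def)
    finally show ?thesis by (simp add: add_right_mono)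
  qed
  show ?thesis
    using CD main unfolding A_def N_def by blast
qed

end
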